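(* Let $\alpha\in(0,1)\cup(1,\infty)$ and let $\rho,\sigma$ be density operators on a complex Hilbert space of finite dimension $n$, with eigenvalue vectors $\mathbf{p}$ and $\mathbf{q}$ (counted with multiplicity). Then $$\widetilde{D'}_\alpha([\rho]\,\|\,[\sigma]):=\min_{U\text{ unitary}}D'_\alpha(U\rho U^\dagger\|\sigma)=\frac{1}{\alpha-1}\ln\left(\sum_{i=1}^n (p_i^\uparrow)^\alpha (q_i^\uparrow)^{1-\alpha}\right).$$ Consequently it equals $\widetilde D_\alpha([\rho]\,\|\,[\sigma]):=\min_{U\text{ unitary}}D_\alpha(U\rho U^\dagger\|\sigma)$, where $D_\alpha$ is the Petz-Rényi relative entropy.
   Context: For $\mathbf{x}\in\mathbb{R}^n$, $\mathbf{x}^\uparrow$ denotes the vector of its components arranged in non-descending order. The sandwiched Rényi relative entropy is $D'_\alpha(\rho\|\sigma):=\frac{1}{\alpha-1}\ln\left(\mathrm{Tr}\left[\left(\sigma^{\frac{1-\alpha}{2\alpha}}\rho\,\sigma^{\frac{1-\alpha}{2\alpha}}\right)^\alpha\right]\right)$ and the Petz-Rényi relative entropy is $D_\alpha(\rho\|\sigma):=\frac{1}{\alpha-1}\ln\left(\mathrm{Tr}\left[\rho^\alpha\sigma^{1-\alpha}\right]\right)$, both with values in $(-\infty,+\infty]$ and with the standard conventions: for $\alpha\in(0,1)$ the value is $+\infty$ when the trace is $0$; for $\alpha>1$ the value is $+\infty$ if the support of $\rho$ is not contained in the support of $\sigma$, and otherwise negative powers of $\sigma$ are taken on the support of $\sigma$.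 Correspondingly, for $\alpha>1$, $p^\alpha q^{1-\alpha}$ is read as $0$ if $p=q=0$ and as $+\infty$ if $p>0=q$, and $\ln(+\infty)=+\infty$. *)

theory Defs
  imports
    "HOL-Library.Extended_Real"
    "Jordan_Normal_Form.Schur_Decomposition"
    "Jordan_Normal_Form.Matrix_Kernel"
begin

text \<open>Operators on an \<open>n\<close>-dimensional complex Hilbert space are represented by their matrices
  in an orthonormal basis, i.e. by elements of \<^term>\<open>carrier_mat n n :: complex mat set\<close>.\<close>

definition mat_trace :: "complex mat \<Rightarrow> complex" where
  "mat_trace A = (\<Sum>i<dim_row A. A $$ (i, i))"

definition unitary_mats :: "nat \<Rightarrow> complex mat set" where
  "unitary_mats n = {U \<in> carrier_mat n n.
     U * mat_adjoint U = 1\<^sub>m n \<and> mat_adjoint U * U = 1\<^sub>m n}"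

text \<open>In the second conjunct \<open>\<le>\<close> is the order of \<^theory>\<open>HOL-Library.Complex_Order\<close>: the value
  of the quadratic form is real and nonnegative.\<close>

definition pos_semidef :: "complex mat \<Rightarrow> bool" where
  "pos_semidef A \<longleftrightarrow> mat_adjoint A = A \<and>
     (\<forall>v \<in> carrier_vec (dim_row A). 0 \<le> (A *\<^sub>v v) \<bullet>c v)"

definition density_ops :: "nat \<Rightarrow> complex mat set" where
  "density_ops n = {A \<in> carrier_mat n n. pos_semidef A \<and> mat_trace A = 1}"

text \<open>\<open>a\<close> lists the eigenvalues of \<open>A\<close> with multiplicity, in any order.\<close>

definition eigenvalue_vector :: "complex mat \<Rightarrow> real list \<Rightarrow> bool" where
  "eigenvalue_vector A a \<longleftrightarrow> length a = dim_row A \<and>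
     char_poly A = (\<Prod>x\<leftarrow>a. [:- complex_of_real x, 1:])"

text \<open>The support of an operator: the orthogonal complement of its kernel.\<close>

definition mat_support :: "complex mat \<Rightarrow> complex vec set" where
  "mat_support A = {v \<in> carrier_vec (dim_col A). \<forall>w \<in> mat_kernel A. v \<bullet>c w = 0}"

text \<open>Functional calculus for Hermitian matrices via unitary diagonalization. The result does
  not depend on the diagonalization: see \<open>mat_fun_eq\<close> below.\<close>

definition mat_fun :: "(real \<Rightarrow> real) \<Rightarrow> complex mat \<Rightarrow> complex mat" where
  "mat_fun f A = (THE B. \<exists>U \<in> unitary_mats (dim_row A). \<exists>d.
     A = U * mat_diag (dim_row A) (\<lambda>i. complex_of_real (d i)) * mat_adjoint U \<and>
     B = U * mat_diag (dim_row A) (\<lambda>i. complex_of_real (f (d i))) * mat_adjoint U)"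

lemma mat_adjoint_carrier [simp, intro]:
  "A \<in> carrier_mat n m \<Longrightarrow> mat_adjoint A \<in> carrier_mat m n"
  by (auto simp: mat_adjoint_def)

lemma mat_fun_unique:
  fixes d e :: "nat \<Rightarrow> real"
  assumes U: "U \<in> unitary_mats n" and V: "V \<in> unitary_mats n"
    and eq: "U * mat_diag n (\<lambda>i. complex_of_real (d i)) * mat_adjoint U
           = V * mat_diag n (\<lambda>i. complex_of_real (e i)) * mat_adjoint V"
  shows "U * mat_diag n (\<lambda>i. complex_of_real (f (d i))) * mat_adjoint U
       = V * mat_diag n (\<lambda>i. complex_of_real (f (e i))) * mat_adjoint V"
proof -
  define U' V' where "U' = mat_adjoint U" and "V' = mat_adjoint V"
  have c: "U \<in> carrier_mat n n" "V \<in> carrier_mat n n" "U' \<in> carrier_mat n n" "V' \<in> carrier_mat n n"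
    using U V by (auto simp: unitary_mats_def U'_def V'_def)
  have u: "U * U' = 1\<^sub>m n" "U' * U = 1\<^sub>m n" "V * V' = 1\<^sub>m n" "V' * V = 1\<^sub>m n"
    using U V by (auto simp: unitary_mats_def U'_def V'_def)
  define W where "W = V' * U"
  have W: "W \<in> carrier_mat n n" using c by (simp add: W_def)
  define D where "D g = mat_diag n (\<lambda>i. complex_of_real (g i))" for g :: "nat \<Rightarrow> real"
  have Dc: "D g \<in> carrier_mat n n" for g by (simp add: D_def)
  have WD: "W * D g = Matrix.mat n n (\<lambda>(i,j). W $$ (i,j) * complex_of_real (g j))" for g
    unfolding D_def using mat_diag_mult_right[OF W] by simp
  have DW: "D g * W = Matrix.mat n n (\<lambda>(i,j). complex_of_real (g i) * W $$ (i,j))" for g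
    unfolding D_def using mat_diag_mult_left[OF W] by simp
  have "W * D d = V' * (U * D d * U') * U"
    unfolding W_def using c u Dc[of d] by (simp add: assoc_mult_mat[of _ n n _ n _ n])
  also have "\<dots> = V' * (V * D e * V') * U"
    using eq by (simp add: D_def U'_def V'_def)
  also have "\<dots> = (V' * V) * D e * W"
    unfolding W_def using c Dc[of e] by (simp add: assoc_mult_mat[of _ n n _ n _ n])
  finally have 1: "W * D d = D e * W" using u Dc[of e] by simp
  have "W $$ (i,j) * complex_of_real (d j) = complex_of_real (e i) * W $$ (i,j)"
    if "i < n" "j < n" for i j
    using arg_cong[OF 1[unfolded WD DW], of "\<lambda>M. M $$ (i,j)"] that by simp
  hence dich: "W $$ (i,j) = 0 \<or> d j = e i" if "i < n" "j < n" for i j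
    using that by (metis mult.commute mult_cancel_right of_real_eq_iff)
  have "W $$ (i,j) * complex_of_real (f (d j)) = complex_of_real (f (e i)) * W $$ (i,j)"
    if "i < n" "j < n" for i j
    using dich[OF that] by auto
  hence 2: "W * D (\<lambda>i. f (d i)) = D (\<lambda>i. f (e i)) * W"
    unfolding WD DW by (intro cong_mat) auto
  have "U * D (\<lambda>i. f (d i)) * U' = (V * V') * U * D (\<lambda>i. f (d i)) * U'"
    using c u by simp
  also have "\<dots> = V * (W * D (\<lambda>i. f (d i))) * U'"
    unfolding W_def using c Dc[of "\<lambda>i. f (d i)"] by (simp add: assoc_mult_mat[of _ n n _ n _ n])
  also have "\<dots> = V * D (\<lambda>i. f (e i)) * V' * (U * U')"
    unfolding 2 unfolding W_def using c Dc[of "\<lambda>i. f (e i)"]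
    by (simp add: assoc_mult_mat[of _ n n _ n _ n])
  also have "\<dots> = V * D (\<lambda>i. f (e i)) * V'"
    using c u Dc[of "\<lambda>i. f (e i)"] by simp
  finally show ?thesis by (simp add: D_def U'_def V'_def)
qed

lemma mat_fun_eq:
  assumes U: "U \<in> unitary_mats n"
    and A: "A = U * mat_diag n (\<lambda>i. complex_of_real (d i)) * mat_adjoint U"
  shows "mat_fun f A = U * mat_diag n (\<lambda>i. complex_of_real (f (d i))) * mat_adjoint U"
proof -
  have n: "dim_row A = n" using U unfolding A by (auto simp: unitary_mats_def)
  show ?thesis
    unfolding mat_fun_def n
  proof (rule the_equality)
    show "\<exists>V\<in>unitary_mats n. \<exists>e.
        A = V * mat_diag n (\<lambda>i. complex_of_real (e i)) * mat_adjoint V \<and>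
        U * mat_diag n (\<lambda>i. complex_of_real (f (d i))) * mat_adjoint U =
        V * mat_diag n (\<lambda>i. complex_of_real (f (e i))) * mat_adjoint V"
      using U A by blast
  next
    fix B
    assume "\<exists>V\<in>unitary_mats n. \<exists>e.
        A = V * mat_diag n (\<lambda>i. complex_of_real (e i)) * mat_adjoint V \<and>
        B = V * mat_diag n (\<lambda>i. complex_of_real (f (e i))) * mat_adjoint V"
    then obtain V e where V: "V \<in> unitary_mats n"
      and AV: "A = V * mat_diag n (\<lambda>i. complex_of_real (e i)) * mat_adjoint V"
      and B: "B = V * mat_diag n (\<lambda>i. complex_of_real (f (e i))) * mat_adjoint V"
      by blast
    show "B = U * mat_diag n (\<lambda>i. complex_of_real (f (d i))) * mat_adjoint U"
      unfolding B by (rule mat_fun_unique[OF V U]) (use A AV in simp)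
  qed
qed

text \<open>Since \<^term>\<open>0 powr s = (0::real)\<close> for every \<open>s\<close>, powers with nonpositive exponent are taken
  on the support.\<close>

definition mat_powr :: "complex mat \<Rightarrow> real \<Rightarrow> complex mat" where
  "mat_powr A s = mat_fun (\<lambda>x. x powr s) A"

definition ereal_ln :: "ereal \<Rightarrow> ereal" where
  "ereal_ln x = (if x = \<infinity> then \<infinity> else if x \<le> 0 then - \<infinity> else ereal (ln (real_of_ereal x)))"

text \<open>In the following definitions the traces are real (and nonnegative) for positive semidefinite
  arguments. For \<open>\<alpha> < 1\<close> and vanishing trace the value is
  \<open>1 / (\<alpha> - 1) * (- \<infinity>) = \<infinity>\<close>.\<close>

definition sandwiched_renyi :: "real \<Rightarrow> complex mat \<Rightarrow> complex mat \<Rightarrow> ereal" where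
  "sandwiched_renyi \<alpha> \<rho> \<sigma> =
     (if 1 < \<alpha> \<and> \<not> mat_support \<rho> \<subseteq> mat_support \<sigma> then \<infinity>
      else ereal (1 / (\<alpha> - 1)) * ereal_ln (ereal (Re (mat_trace
        (mat_powr (mat_powr \<sigma> ((1 - \<alpha>) / (2 * \<alpha>)) * \<rho> * mat_powr \<sigma> ((1 - \<alpha>) / (2 * \<alpha>))) \<alpha>)))))"

definition petz_renyi :: "real \<Rightarrow> complex mat \<Rightarrow> complex mat \<Rightarrow> ereal" where
  "petz_renyi \<alpha> \<rho> \<sigma> =
     (if 1 < \<alpha> \<and> \<not> mat_support \<rho> \<subseteq> mat_support \<sigma> then \<infinity>
      else ereal (1 / (\<alpha> - 1)) * ereal_ln (ereal (Re (mat_trace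
        (mat_powr \<rho> \<alpha> * mat_powr \<sigma> (1 - \<alpha>))))))"

text \<open>The scalar expression \<open>p\<^sup>\<alpha> q\<^sup>1\<^sup>-\<^sup>\<alpha>\<close>; for \<open>p = q = 0\<close> it is \<open>0\<close> because
  \<^term>\<open>0 powr s = (0::real)\<close>.\<close>

definition renyi_summand :: "real \<Rightarrow> real \<Rightarrow> real \<Rightarrow> ereal" where
  "renyi_summand \<alpha> p q =
     (if 1 < \<alpha> \<and> 0 < p \<and> q = 0 then \<infinity> else ereal (p powr \<alpha> * q powr (1 - \<alpha>)))"

text \<open>The minima over the unitary orbit, as infima; attainment is to be asserted separately.\<close>

definition orbit_sandwiched_renyi :: "real \<Rightarrow> complex mat \<Rightarrow> complex mat \<Rightarrow> ereal" where
  "orbit_sandwiched_renyi \<alpha> \<rho> \<sigma> =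
     (INF U \<in> unitary_mats (dim_row \<rho>). sandwiched_renyi \<alpha> (U * \<rho> * mat_adjoint U) \<sigma>)"

definition orbit_petz_renyi :: "real \<Rightarrow> complex mat \<Rightarrow> complex mat \<Rightarrow> ereal" where
  "orbit_petz_renyi \<alpha> \<rho> \<sigma> =
     (INF U \<in> unitary_mats (dim_row \<rho>). petz_renyi \<alpha> (U * \<rho> * mat_adjoint U) \<sigma>)"

end

theory Submission
  imports Defs
begin

text \<open>Both traces are instances of \<open>Tr (\<sigma>\<^sup>s \<rho>\<^bsup>\<alpha>/z\<^esup> \<sigma>\<^sup>s)\<^sup>z\<close> with \<open>s = (1 - \<alpha>) / 2z\<close>, so it suffices to
  compare this functional with \<open>\<Sum> p\<^sub>i\<^sup>\<alpha> q\<^sub>i\<^bsup>1-\<alpha>\<^esup>\<close>. The eigenvalues \<open>x\<close> of \<open>L diag(b) L\<^sup>*\<close> and the eigenvalues \<open>a\<close> of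
  \<open>L L\<^sup>*\<close> satisfy Lidskii's majorization \<open>ln x - ln a \<prec> ln b\<close>. By convexity it yields
  \<open>\<Sum> x\<^sub>i\<^sup>r \<le> \<Sum> (a\<^sub>i b\<^sub>i)\<^sup>r\<close> and \<open>\<Sum> (x\<^sub>i / a\<^sub>i)\<^sup>r \<le> \<Sum> b\<^sub>i\<^sup>r\<close>. The first inequality, with \<open>b\<close> the
  spectrum of \<open>\<rho>\<^bsup>\<alpha>/z\<^esup>\<close>, settles \<open>\<alpha> < 1\<close>. For \<open>\<alpha> > 1\<close> one writes \<open>\<rho>\<^bsup>\<alpha>/z\<^esup> = \<sigma>\<^bsup>-s\<^esup> X \<sigma>\<^bsup>-s\<^esup>\<close>, where now
  \<open>-s > 0\<close>, and applies the second one with \<open>b\<close> the spectrum of \<open>X\<close>. Equality holds when \<open>\<rho>\<close> and \<open>\<sigma>\<close>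
  share an eigenbasis in which both spectra are ascending.\<close>

abbreviation real_diag :: "nat \<Rightarrow> (nat \<Rightarrow> real) \<Rightarrow> complex mat" where
  "real_diag n d \<equiv> mat_diag n (\<lambda>i. complex_of_real (d i))"

text \<open>For unitary \<open>L\<close> this is a spectral decomposition, for general
  \<open>L\<close> a congruence. An equation between one of each says that the diagonal of the
  former is the spectrum of the latter.\<close>

abbreviation conj_diag :: "nat \<Rightarrow> complex mat \<Rightarrow> (nat \<Rightarrow> real) \<Rightarrow> complex mat" where
  "conj_diag n L d \<equiv> L * real_diag n d * mat_adjoint L"

subsection \<open>Adjoints and unitary matrices\<close>

lemmas assoc_square = assoc_mult_mat[of _ n n _ n _ n for n]

lemma mult_carrier_square [simp]:
  "A \<in> carrier_mat n n \<Longrightarrow> B \<in> carrier_mat n n \<Longrightarrow> A * B \<in> carrier_mat n n"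
  by simp

lemma mat_adjoint_eq: "mat_adjoint A = Matrix.mat (dim_col A) (dim_row A) (\<lambda>(i, j). cnj (A $$ (j, i)))"
  by (rule eq_matI) (auto simp: mat_adjoint_def mat_of_rows_def cols_def)

lemma dim_mat_adjoint [simp]:
  "dim_row (mat_adjoint A) = dim_col (A :: complex mat)" "dim_col (mat_adjoint A) = dim_row A"
  by (simp_all add: mat_adjoint_eq)

lemma mult_mat_vec_carrier_square [simp]:
  "A \<in> carrier_mat n n \<Longrightarrow> v \<in> carrier_vec n \<Longrightarrow> A *\<^sub>v v \<in> carrier_vec n"
  by (rule mult_mat_vec_carrier)

lemma index_mat_adjoint:
  "i < dim_col A \<Longrightarrow> j < dim_row A \<Longrightarrow> mat_adjoint A $$ (i, j) = cnj (A $$ (j, i))"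
  by (simp add: mat_adjoint_eq)

lemma mat_adjoint_adjoint [simp]: "mat_adjoint (mat_adjoint (A :: complex mat)) = A"
  by (rule eq_matI) (auto simp: mat_adjoint_eq)

lemma mat_adjoint_mult:
  fixes A B :: "complex mat"
  assumes "A \<in> carrier_mat n m" and "B \<in> carrier_mat m k"
  shows "mat_adjoint (A * B) = mat_adjoint B * mat_adjoint A"
  using assms by (intro eq_matI) (auto simp: mat_adjoint_eq scalar_prod_def mult.commute)

lemma mat_adjoint_real_diag [simp]: "mat_adjoint (real_diag n d) = real_diag n d"
  by (rule eq_matI) (auto simp: mat_adjoint_eq mat_diag_def)

lemma mat_adjoint_conj_diag:
  assumes "L \<in> carrier_mat n n"
  shows "mat_adjoint (conj_diag n L d) = conj_diag n L d"
  using assms by (simp add: mat_adjoint_mult[of _ n n _ n] assoc_square[of _ n])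

lemma conj_diag_mult:
  assumes "A \<in> carrier_mat n n" and "B \<in> carrier_mat n n"
  shows "A * conj_diag n B d * mat_adjoint A = conj_diag n (A * B) d"
  using assms by (simp add: mat_adjoint_mult[of _ n n _ n] assoc_square[of _ n])

lemma scalar_prod_adjoint:
  fixes A :: "complex mat"
  assumes "A \<in> carrier_mat n m" and "u \<in> carrier_vec m" and "w \<in> carrier_vec n"
  shows "(A *\<^sub>v u) \<bullet>c w = u \<bullet>c (mat_adjoint A *\<^sub>v w)"
proof -
  have "(A *\<^sub>v u) \<bullet>c w = (\<Sum>i<n. \<Sum>j<m. A $$ (i, j) * u $ j * cnj (w $ i))"
    using assms by (auto simp: scalar_prod_def sum_distrib_right atLeast0LessThan intro!: sum.cong)
  also have "\<dots> = (\<Sum>j<m. \<Sum>i<n. A $$ (i, j) * u $ j * cnj (w $ i))"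
    by (rule sum.swap)
  also have "\<dots> = u \<bullet>c (mat_adjoint A *\<^sub>v w)"
    using assms by (auto simp: scalar_prod_def sum_distrib_left atLeast0LessThan mat_adjoint_eq mult_ac
        intro!: sum.cong)
  finally show ?thesis .
qed

lemma unitary_matsD:
  assumes "U \<in> unitary_mats n"
  shows "U \<in> carrier_mat n n" and "mat_adjoint U \<in> carrier_mat n n"
    and "U * mat_adjoint U = 1\<^sub>m n" and "mat_adjoint U * U = 1\<^sub>m n"
  using assms by (auto simp: unitary_mats_def)

lemma unitary_mats_adjoint: "U \<in> unitary_mats n \<Longrightarrow> mat_adjoint U \<in> unitary_mats n"
  by (auto simp: unitary_mats_def)

lemma unitary_matsI:
  assumes "U \<in> carrier_mat n n" and "mat_adjoint U * U = 1\<^sub>m n"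
  shows "U \<in> unitary_mats n"
  using assms mat_mult_left_right_inverse[of "mat_adjoint U" n U] by (auto simp: unitary_mats_def)

lemma unitary_mats_one: "1\<^sub>m n \<in> unitary_mats n"
proof -
  have "mat_adjoint (1\<^sub>m n) = (1\<^sub>m n :: complex mat)"
    by (rule eq_matI) (auto simp: mat_adjoint_eq)
  then show ?thesis by (intro unitary_matsI) auto
qed

lemma mult_unitary_cancel:
  assumes U: "U \<in> unitary_mats n" and A: "A \<in> carrier_mat n m"
  shows "mat_adjoint U * (U * A) = A" "U * (mat_adjoint U * A) = A"
proof -
  note u = unitary_matsD[OF U]
  show "mat_adjoint U * (U * A) = A"
    using u A assoc_mult_mat[of "mat_adjoint U" n n U n A m] by simp
  show "U * (mat_adjoint U * A) = A"
    using u A assoc_mult_mat[of U n n "mat_adjoint U" n A m] by simp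
qed

lemma unitary_mats_mult:
  assumes "U \<in> unitary_mats n" and "V \<in> unitary_mats n"
  shows "U * V \<in> unitary_mats n"
proof (rule unitary_matsI)
  note u = unitary_matsD[OF assms(1)] and v = unitary_matsD[OF assms(2)]
  show "U * V \<in> carrier_mat n n" using u v by auto
  have "mat_adjoint (U * V) * (U * V) = mat_adjoint V * (mat_adjoint U * (U * V))"
    using u v by (simp add: mat_adjoint_mult[of _ n n _ n] assoc_square[of _ n])
  also have "\<dots> = 1\<^sub>m n"
    using mult_unitary_cancel(1)[OF assms(1) v(1)] v by simp
  finally show "mat_adjoint (U * V) * (U * V) = 1\<^sub>m n" .
qed

lemma conj_diag_mult_conj_diag:
  assumes "U \<in> unitary_mats n"
  shows "conj_diag n U d * conj_diag n U e = conj_diag n U (\<lambda>i. d i * e i)"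
proof -
  note u = unitary_matsD[OF assms]
  have "conj_diag n U d * conj_diag n U e
      = U * (real_diag n d * (mat_adjoint U * (U * (real_diag n e * mat_adjoint U))))"
    using u by (simp add: assoc_square[of _ n])
  also have "mat_adjoint U * (U * (real_diag n e * mat_adjoint U)) = real_diag n e * mat_adjoint U"
    using u by (intro mult_unitary_cancel(1)[OF assms, of _ n]) simp
  also have "U * (real_diag n d * (real_diag n e * mat_adjoint U))
      = U * (real_diag n d * real_diag n e) * mat_adjoint U"
    using u by (simp add: assoc_square[of _ n] del: mat_diag_diag)
  finally show ?thesis by simp
qed

lemma conj_diag_carrier [simp]:
  "L \<in> carrier_mat n n \<Longrightarrow> conj_diag n L d \<in> carrier_mat n n"
  by auto

subsection \<open>Quadratic forms\<close>

text \<open>The quadratic form of a real diagonal matrix; constant weight 1 gives the squared norm.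
  Being real-valued, it lets forms be compared without the order on complex numbers.\<close>

definition wnorm :: "nat \<Rightarrow> (nat \<Rightarrow> real) \<Rightarrow> complex vec \<Rightarrow> real" where
  "wnorm n d u = (\<Sum>i<n. d i * (cmod (u $ i))\<^sup>2)"

lemma mult_cnj_self: "z * cnj z = (complex_of_real (cmod z))\<^sup>2"
  by (metis complex_norm_square of_real_power)

lemma cscalar_prod_self:
  "u \<in> carrier_vec n \<Longrightarrow> u \<bullet>c u = complex_of_real (wnorm n (\<lambda>_. 1) u)"
  by (auto simp: scalar_prod_def wnorm_def mult_cnj_self atLeast0LessThan intro!: sum.cong)

text \<open>Moving the left factor \<open>L\<close> across the inner product leaves a diagonal form
  in the coordinates \<open>mat_adjoint L *\<^sub>v v\<close>.\<close>

lemma quadratic_form_conj_diag: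
  assumes L: "L \<in> carrier_mat n n" and v: "v \<in> carrier_vec n"
  shows "(conj_diag n L d *\<^sub>v v) \<bullet>c v = complex_of_real (wnorm n d (mat_adjoint L *\<^sub>v v))"
proof -
  define u where "u = mat_adjoint L *\<^sub>v v"
  have u: "u \<in> carrier_vec n" using L v by (simp add: u_def)
  have "conj_diag n L d *\<^sub>v v = L *\<^sub>v (real_diag n d *\<^sub>v u)"
    using L v u by (simp add: u_def assoc_mult_mat_vec[of _ n n _ n] assoc_square[of _ n])
  then have "(conj_diag n L d *\<^sub>v v) \<bullet>c v = (real_diag n d *\<^sub>v u) \<bullet>c u"
    using scalar_prod_adjoint[OF L _ v, of "real_diag n d *\<^sub>v u"] u by (simp add: u_def)
  also have "real_diag n d *\<^sub>v u = Matrix.vec n (\<lambda>i. complex_of_real (d i) * u $ i)"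
    using u by (intro eq_vecI)
      (auto simp: mat_diag_def scalar_prod_def if_distrib[of "\<lambda>x. x * _"] sum.delta cong: if_cong)
  also have "\<dots> \<bullet>c u = complex_of_real (wnorm n d u)"
    using u by (auto simp: scalar_prod_def wnorm_def mult_cnj_self atLeast0LessThan mult_ac
        intro!: sum.cong)
  finally show ?thesis by (simp add: u_def)
qed

lemma wnorm_unitary:
  assumes "U \<in> unitary_mats n" and v: "v \<in> carrier_vec n"
  shows "wnorm n (\<lambda>_. 1) (mat_adjoint U *\<^sub>v v) = wnorm n (\<lambda>_. 1) v"
proof -
  note u = unitary_matsD[OF assms(1)]
  have "complex_of_real (wnorm n (\<lambda>_. 1) (mat_adjoint U *\<^sub>v v)) = (conj_diag n U (\<lambda>_. 1) *\<^sub>v v) \<bullet>c v"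
    by (rule quadratic_form_conj_diag[OF u(1) v, symmetric])
  also have "\<dots> = v \<bullet>c v"
    using u v by simp
  also have "\<dots> = complex_of_real (wnorm n (\<lambda>_. 1) v)"
    by (rule cscalar_prod_self[OF v])
  finally show ?thesis by (simp only: of_real_eq_iff)
qed

lemma wnorm_pos:
  assumes "v \<in> carrier_vec n" and "v \<noteq> 0\<^sub>v n"
  shows "0 < wnorm n (\<lambda>_. 1) v"
proof -
  obtain i where "i < n" "v $ i \<noteq> 0"
    using assms by (metis carrier_vecD eq_vecI index_zero_vec)
  then show ?thesis
    unfolding wnorm_def by (intro sum_pos2[of _ i]) auto
qed

lemma wnorm_nonneg: "(\<And>i. i < n \<Longrightarrow> 0 \<le> d i) \<Longrightarrow> 0 \<le> wnorm n d u"
  unfolding wnorm_def by (intro sum_nonneg) auto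

lemma wnorm_mono: "(\<And>i. i < n \<Longrightarrow> d i \<le> e i) \<Longrightarrow> wnorm n d u \<le> wnorm n e u"
  unfolding wnorm_def by (intro sum_mono mult_right_mono) auto

lemma wnorm_scale: "wnorm n (\<lambda>i. c * d i) u = c * wnorm n d u"
  by (simp add: wnorm_def sum_distrib_left mult_ac)

lemma wnorm_add: "wnorm n (\<lambda>i. d i + e i) u = wnorm n d u + wnorm n e u"
  by (simp add: wnorm_def sum.distrib algebra_simps)

text \<open>Both sides are the quadratic form of one matrix. This turns spectral equations into the
  form comparisons on which Weyl monotonicity operates.\<close>

lemma wnorm_cong_conj_diag:
  assumes "L \<in> carrier_mat n n" and "M \<in> carrier_mat n n" and "v \<in> carrier_vec n"
    and "conj_diag n L d = conj_diag n M e"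
  shows "wnorm n d (mat_adjoint L *\<^sub>v v) = wnorm n e (mat_adjoint M *\<^sub>v v)"
  using quadratic_form_conj_diag[of L n v d] quadratic_form_conj_diag[of M n v e] assms
  by (metis of_real_eq_iff)

subsection \<open>Weyl monotonicity\<close>

text \<open>A dimension count: the columns of \<open>U\<close> with index at least \<open>i\<close>
  and those of \<open>V\<close> with index at most \<open>i\<close> span subspaces of dimensions
  \<open>n - i\<close> and \<open>i + 1\<close>, which share a nonzero \<open>x\<close>. On
  \<open>x\<close> the first form is at least \<open>d i\<close>, and the second at most
  \<open>e i\<close>, times the squared norm.\<close>

lemma weyl_monotone:
  assumes U: "U \<in> unitary_mats n" and V: "V \<in> unitary_mats n"
    and d: "mono_on {..<n} d" and e: "mono_on {..<n} e" and i: "i < n"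
    and le: "\<And>v. v \<in> carrier_vec n \<Longrightarrow>
      wnorm n d (mat_adjoint U *\<^sub>v v) \<le> wnorm n e (mat_adjoint V *\<^sub>v v)"
  shows "d i \<le> e i"
proof -
  note u = unitary_matsD[OF U] and v = unitary_matsD[OF V]
  \<comment> \<open>A kernel vector of \<open>M\<close> is orthogonal to the eigenvectors of \<open>d\<close> below \<open>i\<close> and to those of
    \<open>e\<close> above \<open>i\<close>; \<open>M\<close> is singular because its row \<open>i\<close> vanishes.\<close>
  define M where "M = Matrix.mat n n (\<lambda>(k, j). if k < i then mat_adjoint U $$ (k, j)
    else if k = i then 0 else mat_adjoint V $$ (k, j))"
  have M: "M \<in> carrier_mat n n" by (simp add: M_def)
  have rowU: "row M k = row (mat_adjoint U) k" if "k < i" for k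
    using that i by (intro eq_vecI) (auto simp: M_def carrier_matD[OF u(1)])
  have rowV: "row M k = row (mat_adjoint V) k" if "i < k" "k < n" for k
    using that by (intro eq_vecI) (auto simp: M_def carrier_matD[OF v(1)])
  have "M = mat\<^sub>r n n (\<lambda>k. if k = i then 0\<^sub>v n else row M k)"
    by (intro eq_matI) (auto simp: M_def)
  then have "det M = 0"
    using det_row_0[OF i, of "\<lambda>k. row M k"] M by (simp add: Pi_def)
  then obtain x where x: "x \<in> carrier_vec n" "x \<noteq> 0\<^sub>v n" and Mx: "M *\<^sub>v x = 0\<^sub>v n"
    using det_0_iff_vec_prod_zero_field[OF M] by blast
  have row0: "row M k \<bullet> x = 0" if "k < n" for k
    using arg_cong[OF Mx, of "\<lambda>w. w $ k"] that M by simp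
  have xU: "(mat_adjoint U *\<^sub>v x) $ k = 0" if "k < i" for k
    using row0[of k] that i u rowU by simp
  have xV: "(mat_adjoint V *\<^sub>v x) $ k = 0" if "i < k" "k < n" for k
    using row0[of k] that v rowV by simp
  have "d i * wnorm n (\<lambda>_. 1) x = wnorm n (\<lambda>_. d i * 1) (mat_adjoint U *\<^sub>v x)"
    by (simp only: wnorm_scale wnorm_unitary[OF U x(1)])
  also have "\<dots> \<le> wnorm n d (mat_adjoint U *\<^sub>v x)"
    unfolding wnorm_def
  proof (intro sum_mono)
    fix k assume k: "k \<in> {..<n}"
    show "d i * 1 * (cmod ((mat_adjoint U *\<^sub>v x) $ k))\<^sup>2 \<le> d k * (cmod ((mat_adjoint U *\<^sub>v x) $ k))\<^sup>2"
      using xU[of k] k i mono_onD[OF d, of i k] by (cases "k < i") (auto intro!: mult_right_mono)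
  qed
  also have "\<dots> \<le> wnorm n e (mat_adjoint V *\<^sub>v x)" by (rule le[OF x(1)])
  also have "\<dots> \<le> wnorm n (\<lambda>_. e i * 1) (mat_adjoint V *\<^sub>v x)"
    unfolding wnorm_def
  proof (intro sum_mono)
    fix k assume k: "k \<in> {..<n}"
    show "e k * (cmod ((mat_adjoint V *\<^sub>v x) $ k))\<^sup>2 \<le> e i * 1 * (cmod ((mat_adjoint V *\<^sub>v x) $ k))\<^sup>2"
      using xV[of k] k i mono_onD[OF e, of k i] by (cases "i < k") (auto intro!: mult_right_mono)
  qed
  also have "\<dots> = e i * wnorm n (\<lambda>_. 1) x"
    by (simp only: wnorm_scale wnorm_unitary[OF V x(1)])
  finally show ?thesis using wnorm_pos[OF x] by simp
qed

subsection \<open>Spectral theorem\<close>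

text \<open>Complete \<open>v\<close> to a basis, orthogonalize and normalize. Gram-Schmidt keeps
  the first vector, and normalization only rescales it, so column 0 remains an eigenvector whenever
  \<open>v\<close> is one.\<close>

lemma unitary_with_eigenvector_column:
  fixes v :: "complex vec"
  assumes v: "v \<in> carrier_vec n" "v \<noteq> 0\<^sub>v n"
  obtains W c where "W \<in> unitary_mats n" and "col W 0 = c \<cdot>\<^sub>v v"
proof -
  interpret cof_vec_space n "TYPE(complex)" .
  define ws where "ws = gram_schmidt n (basis_completion v)"
  from basis_completion[OF v]
  have b: "distinct (basis_completion v)" "\<not> lin_dep (set (basis_completion v))"
    "set (basis_completion v) \<subseteq> carrier_vec n" "hd (basis_completion v) = v"
    "length (basis_completion v) = n"
    by auto
  have n: "0 < n" using v by (cases n) auto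
  from gram_schmidt_result[OF b(3) b(1) b(2) refl, folded ws_def]
  have ws: "set ws \<subseteq> carrier_vec n" "corthogonal ws" "length ws = n"
    using b by auto
  obtain vs where "basis_completion v = v # vs" using b n by (cases "basis_completion v") auto
  then have hd: "ws ! 0 = v"
    using gram_schmidt_hd[OF v(1), of vs] ws(3) n hd_conv_nth[of ws]
    by (metis length_0_conv less_irrefl ws_def)
  define nr where "nr i = sqrt (wnorm n (\<lambda>_. 1) (ws ! i))" for i
  have wsc: "ws ! i \<in> carrier_vec n" if "i < n" for i using ws that by auto
  have orth: "(ws ! i) \<bullet>c (ws ! j) = (if i = j then complex_of_real ((nr i)\<^sup>2) else 0)"
    if "i < n" "j < n" for i j
    using corthogonalD[OF ws(2), of i j] that ws(3) wsc
    by (auto simp: cscalar_prod_self nr_def wnorm_nonneg)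
  have nr0: "nr i \<noteq> 0" if "i < n" for i
    using orth[of i i] corthogonalD[OF ws(2), of i i] that ws(3) by auto
  define W where "W = Matrix.mat n n (\<lambda>(k, i). (ws ! i) $ k / complex_of_real (nr i))"
  have "mat_adjoint W * W = 1\<^sub>m n"
  proof (rule eq_matI)
    fix i j assume ij: "i < dim_row (1\<^sub>m n :: complex mat)" "j < dim_col (1\<^sub>m n :: complex mat)"
    then have "(mat_adjoint W * W) $$ (i, j)
      = (ws ! j) \<bullet>c (ws ! i) / (complex_of_real (nr i) * complex_of_real (nr j))"
      using wsc[of i] by (auto simp: W_def mat_adjoint_eq scalar_prod_def sum_divide_distrib mult_ac
          intro!: sum.cong)
    then show "(mat_adjoint W * W) $$ (i, j) = 1\<^sub>m n $$ (i, j)"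
      using orth[of j i] nr0[of j] ij by (auto simp: power2_eq_square)
  qed (auto simp: W_def)
  then have "W \<in> unitary_mats n" by (intro unitary_matsI) (auto simp: W_def)
  moreover have "col W 0 = (1 / complex_of_real (nr 0)) \<cdot>\<^sub>v v"
    using n v by (intro eq_vecI) (auto simp: W_def hd)
  ultimately show ?thesis by (rule that)
qed

lemma block_diag_mult:
  assumes "E \<in> carrier_mat k k" and "F \<in> carrier_mat k k"
    and "A \<in> carrier_mat m m" and "B \<in> carrier_mat m m"
  shows "four_block_mat E (0\<^sub>m k m) (0\<^sub>m m k) A * four_block_mat F (0\<^sub>m k m) (0\<^sub>m m k) B
    = four_block_mat (E * F) (0\<^sub>m k m) (0\<^sub>m m k) (A * B)"
  using assms by (subst mult_four_block_mat[of _ k k _ m _ m _ _ k _ m]) auto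

text \<open>Deflation by induction on the list: conjugating with a unitary whose first column is an
  eigenvector for the head clears the first column, and by Hermitian symmetry the first row. The
  order of \<open>es\<close> is kept on the diagonal, so any prescribed ordering of the spectrum can
  be realized.\<close>

lemma hermitian_diagonalization:
  assumes "A \<in> carrier_mat n n" and "mat_adjoint A = A"
    and "char_poly A = (\<Prod>x\<leftarrow>es. [:- complex_of_real x, 1:])"
  shows "\<exists>U \<in> unitary_mats n. A = conj_diag n U (\<lambda>i. es ! i)"
  using assms
proof (induction es arbitrary: n A)
  case Nil
  then have "n = 0" using degree_monic_char_poly[of A n] by auto
  then show ?case using Nil unitary_mats_one[of n] by (intro bexI[of _ "1\<^sub>m n"]) auto
next
  case (Cons e es)
  note A = Cons.prems(1) and herm = Cons.prems(2) and cp = Cons.prems(3)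
  have "degree (char_poly A) \<noteq> 0"
    unfolding cp degree_linear_factors by simp
  then obtain m where n: "n = Suc m"
    using degree_monic_char_poly[OF A] by (cases n) auto
  have "eigenvalue A (complex_of_real e)"
    unfolding eigenvalue_root_char_poly[OF A] cp by simp
  then obtain v where v: "v \<in> carrier_vec n" "v \<noteq> 0\<^sub>v n" "A *\<^sub>v v = complex_of_real e \<cdot>\<^sub>v v"
    using A unfolding eigenvalue_def eigenvector_def by auto
  obtain W c where W: "W \<in> unitary_mats n" and W0: "col W 0 = c \<cdot>\<^sub>v v"
    using unitary_with_eigenvector_column[OF v(1,2)] .
  note w = unitary_matsD[OF W]
  define A' where "A' = mat_adjoint W * A * W"
  have A': "A' \<in> carrier_mat n n" using w A by (simp add: A'_def)
  have herm': "mat_adjoint A' = A'"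
    using w A herm by (simp add: A'_def mat_adjoint_mult[of _ n n _ n] assoc_square[of _ n])
  have n0: "0 < n" using n by simp
  have c0: "col W 0 \<in> carrier_vec n" using w n0 by auto
  have "A *\<^sub>v col W 0 = complex_of_real e \<cdot>\<^sub>v col W 0"
    unfolding W0 mult_mat_vec[OF A v(1)] v(3) smult_smult_assoc by (simp add: mult.commute)
  then have "col (A * W) 0 = complex_of_real e \<cdot>\<^sub>v col W 0"
    using col_mult2[OF A w(1) n0] by simp
  moreover have "A' = mat_adjoint W * (A * W)"
    using w A by (simp add: A'_def assoc_square[of _ n])
  then have "col A' 0 = mat_adjoint W *\<^sub>v col (A * W) 0"
    using col_mult2[OF w(2) _ n0, of "A * W"] w A by simp
  ultimately have "col A' 0 = complex_of_real e \<cdot>\<^sub>v (mat_adjoint W *\<^sub>v col W 0)"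
    using mult_mat_vec[OF w(2) c0] by simp
  also have "mat_adjoint W *\<^sub>v col W 0 = col (mat_adjoint W * W) 0"
    by (rule col_mult2[OF w(2,1) n0, symmetric])
  finally have "col A' 0 = complex_of_real e \<cdot>\<^sub>v col (mat_adjoint W * W) 0" .
  then have colA': "col A' 0 = complex_of_real e \<cdot>\<^sub>v unit_vec n 0"
    using w n by simp
  then have A'0: "A' $$ (i, 0) = (if i = 0 then complex_of_real e else 0)" if "i < n" for i
  proof -
    have "A' $$ (i, 0) = col A' 0 $ i" using that n0 A' by auto
    then show ?thesis using that n0 unfolding colA' by simp
  qed
  have sym: "cnj (A' $$ (j, i)) = A' $$ (i, j)" if "i < n" "j < n" for i j
    using index_mat_adjoint[of i A' j] that A' herm' by auto
  have A'0r: "A' $$ (0, i) = (if i = 0 then complex_of_real e else 0)" if "i < n" for i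
    using A'0[OF that] sym[of 0 i] n that by auto
  define E where "E = Matrix.mat 1 1 (\<lambda>_. complex_of_real e)"
  define A3 where "A3 = Matrix.mat m m (\<lambda>(i, j). A' $$ (Suc i, Suc j))"
  have cE: "E \<in> carrier_mat 1 1" and cA3: "A3 \<in> carrier_mat m m" by (auto simp: E_def A3_def)
  have blk: "A' = four_block_mat E (0\<^sub>m 1 m) (0\<^sub>m m 1) A3"
    using A' n A'0 A'0r by (intro eq_matI) (auto simp: E_def A3_def)
  \<comment> \<open>Similarity preserves the characteristic polynomial and the block form factors
    it; cancelling the linear factor of \<open>e\<close> leaves the polynomial of the remaining
    list, as the induction hypothesis requires.\<close>
  have "similar_mat A' A"
    unfolding similar_mat_def
    by (intro exI, rule similar_mat_witI[of "mat_adjoint W" W n])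
      (use w A A' in \<open>auto simp: A'_def\<close>)
  then have "char_poly A' = char_poly A" by (rule char_poly_similar)
  moreover have "char_poly A' = char_poly E * char_poly A3"
    unfolding blk by (rule char_poly_four_block_zeros_col[OF cE _ cA3]) simp
  moreover have "char_poly E = [:- complex_of_real e, 1:]"
    by (simp add: E_def char_poly_defs det_def sign_def)
  ultimately have "[:- complex_of_real e, 1:] * char_poly A3
      = [:- complex_of_real e, 1:] * (\<Prod>x\<leftarrow>es. [:- complex_of_real x, 1:])"
    using cp by simp
  then have cp3: "char_poly A3 = (\<Prod>x\<leftarrow>es. [:- complex_of_real x, 1:])"
    by (subst (asm) mult_cancel_left) simp
  have herm3: "mat_adjoint A3 = A3"
    using sym n by (intro eq_matI) (auto simp: A3_def index_mat_adjoint)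
  obtain U where U: "U \<in> unitary_mats m" and A3: "A3 = conj_diag m U (\<lambda>i. es ! i)"
    using Cons.IH[OF cA3 herm3 cp3] by blast
  note u = unitary_matsD[OF U]
  define U1 where "U1 = four_block_mat (1\<^sub>m 1) (0\<^sub>m 1 m) (0\<^sub>m m 1) U"
  have U1a: "mat_adjoint U1 = four_block_mat (1\<^sub>m 1) (0\<^sub>m 1 m) (0\<^sub>m m 1) (mat_adjoint U)"
    using u unfolding U1_def by (intro eq_matI) (auto simp: mat_adjoint_eq)
  have U1c: "U1 \<in> carrier_mat n n" using u n by (auto simp: U1_def)
  have diag: "real_diag n (\<lambda>i. (e # es) ! i) = four_block_mat E (0\<^sub>m 1 m) (0\<^sub>m m 1) (real_diag m (\<lambda>i. es ! i))"
    using n by (intro eq_matI) (auto simp: mat_diag_def E_def nth_Cons')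
  have "mat_adjoint U1 * U1 = four_block_mat (1\<^sub>m 1) (0\<^sub>m 1 m) (0\<^sub>m m 1) (1\<^sub>m m)"
    unfolding U1a unfolding U1_def
    using block_diag_mult[of "1\<^sub>m 1" 1 "1\<^sub>m 1", OF _ _ u(2,1)] u by simp
  also have "\<dots> = 1\<^sub>m n" using n by (intro eq_matI) auto
  finally have U1: "U1 \<in> unitary_mats n" using U1c by (intro unitary_matsI)
  have "A' = conj_diag n U1 (\<lambda>i. (e # es) ! i)"
    unfolding blk U1a diag unfolding U1_def
    using block_diag_mult[OF _ cE u(1), of "1\<^sub>m 1" "real_diag m (\<lambda>i. es ! i)"]
      block_diag_mult[OF cE _ _ u(2), of "1\<^sub>m 1" "U * real_diag m (\<lambda>i. es ! i)"] u cE A3 by simp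
  moreover have "A = W * A' * mat_adjoint W"
    using w A mult_unitary_cancel[OF W, of _ n] by (simp add: A'_def assoc_square[of _ n])
  ultimately have "A = conj_diag n (W * U1) (\<lambda>i. (e # es) ! i)"
    using w U1c conj_diag_mult[of W n U1] by simp
  then show ?case using unitary_mats_mult[OF W U1] by blast
qed

text \<open>The characteristic polynomial splits over the complex numbers, Hermitian symmetry makes
  its roots real, and the sorted roots can be prescribed in
  \<open>hermitian_diagonalization\<close>.\<close>

lemma hermitian_diagonalization_sorted:
  assumes A: "A \<in> carrier_mat n n" and herm: "mat_adjoint A = A"
  obtains U d where "U \<in> unitary_mats n" and "mono_on {..<n} d" and "A = conj_diag n U d"
proof -
  obtain as where cp: "char_poly A = (\<Prod>a\<leftarrow>as. [:- a, 1:])" and len: "length as = n"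
    using char_poly_factorized[OF A] by blast
  have real: "complex_of_real (Re a) = a" if "a \<in> set as" for a
  proof -
    have "eigenvalue A a"
      unfolding eigenvalue_root_char_poly[OF A] cp by (rule linear_poly_root[OF that])
    then obtain v where v: "v \<in> carrier_vec n" "v \<noteq> 0\<^sub>v n" "A *\<^sub>v v = a \<cdot>\<^sub>v v"
      using A unfolding eigenvalue_def eigenvector_def by auto
    have "a * (v \<bullet>c v) = (A *\<^sub>v v) \<bullet>c v" using v by simp
    also have "\<dots> = v \<bullet>c (A *\<^sub>v v)" using scalar_prod_adjoint[OF A v(1) v(1)] herm by simp
    also have "\<dots> = cnj a * (v \<bullet>c v)" using v by (simp add: conjugate_smult_vec)
    finally have "a = cnj a" using wnorm_pos[OF v(1,2)] cscalar_prod_self[OF v(1)] by simp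
    then show ?thesis by (metis Reals_cnj_iff complex_is_Real_iff of_real_Re)
  qed
  define es where "es = sort (map Re as)"
  have "mset es = mset (map Re as)" by (simp add: es_def)
  then have "mset (map (\<lambda>x. [:- complex_of_real x, 1:]) es)
      = mset (map (\<lambda>x. [:- complex_of_real x, 1:]) (map Re as))"
    unfolding mset_map by simp
  then have "(\<Prod>x\<leftarrow>es. [:- complex_of_real x, 1:]) = (\<Prod>x\<leftarrow>map Re as. [:- complex_of_real x, 1:])"
    by (metis prod_mset_prod_list)
  also have "\<dots> = (\<Prod>a\<leftarrow>as. [:- a, 1:])"
    using real by (simp add: o_def cong: map_cong)
  finally obtain U where U: "U \<in> unitary_mats n" "A = conj_diag n U (\<lambda>i. es ! i)"
    using hermitian_diagonalization[OF A herm, of es] cp by metis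
  have "mono_on {..<n} (\<lambda>i. es ! i)"
    using len by (intro mono_onI) (auto simp: es_def intro!: sorted_nth_mono)
  then show ?thesis using that U by blast
qed

subsection \<open>Eigenvalues of congruent diagonal matrices\<close>

lemma det_conj_diag:
  assumes "L \<in> carrier_mat n n"
  shows "det (conj_diag n L d) = det L * det (mat_adjoint L) * complex_of_real (\<Prod>i<n. d i)"
proof -
  have "det (real_diag n d) = (\<Prod>i<n. complex_of_real (d i))"
    by (subst det_upper_triangular[of _ n])
      (auto simp: mat_diag_def prod_list_diag_prod atLeast0LessThan)
  then show ?thesis
    using assms by (simp add: det_mult[of _ n])
qed

lemma det_conj_diag_unitary:
  assumes "U \<in> unitary_mats n"
  shows "det (conj_diag n U d) = complex_of_real (\<Prod>i<n. d i)"
proof -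
  note u = unitary_matsD[OF assms]
  have "det U * det (mat_adjoint U) = 1"
    using det_mult[OF u(1,2)] u(3) by simp
  then show ?thesis using det_conj_diag[OF u(1)] by simp
qed

text \<open>With a common \<open>L\<close>, an entrywise inequality of the weights is an inequality
  of quadratic forms, which Weyl monotonicity passes to the sorted spectra. The condition
  \<open>0 \<le> c\<close> keeps the scaled spectrum ascending.\<close>

lemma eigenvalues_congruence_mono:
  assumes L: "L \<in> carrier_mat n n" and Y: "Y \<in> unitary_mats n" "Z \<in> unitary_mats n"
    and x: "mono_on {..<n} x" and z: "mono_on {..<n} z" and c: "0 \<le> c" and i: "i < n"
    and eq: "conj_diag n L b = conj_diag n Y x" "conj_diag n L b' = conj_diag n Z z"
    and le: "\<And>i. i < n \<Longrightarrow> b i \<le> c * b' i"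
  shows "x i \<le> c * z i"
proof (rule weyl_monotone[OF Y x _ i])
  show "mono_on {..<n} (\<lambda>i. c * z i)"
    using z c by (auto simp: mono_on_def intro!: mult_left_mono)
  fix v :: "complex vec" assume v: "v \<in> carrier_vec n"
  have "wnorm n x (mat_adjoint Y *\<^sub>v v) = wnorm n b (mat_adjoint L *\<^sub>v v)"
    by (rule wnorm_cong_conj_diag[OF _ L v eq(1)[symmetric]]) (rule unitary_matsD[OF Y(1)])
  also have "\<dots> \<le> wnorm n (\<lambda>i. c * b' i) (mat_adjoint L *\<^sub>v v)"
    by (rule wnorm_mono[OF le])
  also have "\<dots> = c * wnorm n b' (mat_adjoint L *\<^sub>v v)"
    by (rule wnorm_scale)
  also have "\<dots> = c * wnorm n z (mat_adjoint Z *\<^sub>v v)"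
    using wnorm_cong_conj_diag[OF L _ v eq(2)] unitary_matsD[OF Y(2)] by simp
  also have "\<dots> = wnorm n (\<lambda>i. c * z i) (mat_adjoint Z *\<^sub>v v)"
    by (rule wnorm_scale[symmetric])
  finally show "wnorm n x (mat_adjoint Y *\<^sub>v v) \<le> wnorm n (\<lambda>i. c * z i) (mat_adjoint Z *\<^sub>v v)" .
qed

section \<open>Multiplicative Lidskii majorization for invertible congruences\<close>

lemma sorting_permutation:
  fixes y :: "nat \<Rightarrow> real"
  obtains p where "p permutes {..<n}" and "mono_on {..<n} (\<lambda>i. y (p i))"
proof -
  define js where "js = sort_key y [0..<n]"
  define p where "p i = (if i < n then js ! i else i)" for i
  have js: "distinct js" "set js = {..<n}" "length js = n" by (auto simp: js_def)
  have "bij_betw ((!) js) {..<n} {..<n}"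
    by (rule bij_betw_nth) (simp_all add: js)
  then have "bij_betw p {..<n} {..<n}"
    by (rule bij_betw_cong[THEN iffD1, rotated]) (simp add: p_def)
  then have "p permutes {..<n}" by (rule bij_imp_permutes) (simp add: p_def)
  moreover have "sorted (map y js)" by (simp add: js_def)
  then have "mono_on {..<n} (\<lambda>i. y (p i))"
    using js by (auto simp: mono_on_def p_def sorted_iff_nth_mono)
  ultimately show ?thesis by (rule that)
qed

text \<open>Constant weight 1 makes \<open>gram\<close> say that \<open>a\<close> is the ascending
  spectrum of \<open>L\<close> times its adjoint; positivity of \<open>a\<close> then makes
  \<open>L\<close> invertible.\<close>

locale congruence =
  fixes n :: nat and L Y\<^sub>0 :: "complex mat" and a :: "nat \<Rightarrow> real"
  assumes L: "L \<in> carrier_mat n n" and Y\<^sub>0: "Y\<^sub>0 \<in> unitary_mats n"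
    and a: "mono_on {..<n} a" "\<And>i. i < n \<Longrightarrow> 0 < a i"
    and gram: "conj_diag n L (\<lambda>_. 1) = conj_diag n Y\<^sub>0 a"
begin

definition eigenvalues_at :: "(nat \<Rightarrow> real) \<Rightarrow> (nat \<Rightarrow> real) \<Rightarrow> bool" where
  "eigenvalues_at b x \<longleftrightarrow>
     mono_on {..<n} x \<and> (\<exists>Y \<in> unitary_mats n. conj_diag n L b = conj_diag n Y x)"

lemma eigenvalues_at_exists: "\<exists>x. eigenvalues_at b x"
proof -
  obtain Y x where "Y \<in> unitary_mats n" "mono_on {..<n} x" "conj_diag n L b = conj_diag n Y x"
    using hermitian_diagonalization_sorted[OF conj_diag_carrier[OF L] mat_adjoint_conj_diag[OF L]] .
  then show ?thesis unfolding eigenvalues_at_def by blast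
qed

lemma eigenvalues_at_cong:
  assumes "eigenvalues_at b x" and "\<And>i. i < n \<Longrightarrow> b i = b' i"
  shows "eigenvalues_at b' x"
proof -
  have "real_diag n b = real_diag n b'"
    using assms(2) by (intro eq_matI) (auto simp: mat_diag_def)
  then show ?thesis using assms(1) by (simp add: eigenvalues_at_def)
qed

lemma eigenvalues_at_one: "eigenvalues_at (\<lambda>_. 1) a"
  using Y\<^sub>0 a gram by (auto simp: eigenvalues_at_def)

lemma eigenvalues_at_mono:
  assumes "eigenvalues_at b x" and "eigenvalues_at b' z" and "0 \<le> c" and "i < n"
    and "\<And>i. i < n \<Longrightarrow> b i \<le> c * b' i"
  shows "x i \<le> c * z i"
proof -
  obtain Y Z where "Y \<in> unitary_mats n" "Z \<in> unitary_mats n"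
    "conj_diag n L b = conj_diag n Y x" "conj_diag n L b' = conj_diag n Z z"
    using assms(1,2) by (auto simp: eigenvalues_at_def)
  moreover have "mono_on {..<n} x" "mono_on {..<n} z"
    using assms(1,2) by (simp_all add: eigenvalues_at_def)
  ultimately show ?thesis
    using eigenvalues_congruence_mono[OF L] assms(3-5) by blast
qed

text \<open>Scaled by its largest reciprocal, \<open>b\<close> dominates the constant weight 1,
  whose eigenvalues \<open>a\<close> are positive; monotonicity carries the positivity over to
  \<open>x\<close>.\<close>

lemma eigenvalues_at_pos:
  assumes x: "eigenvalues_at b x" and b: "\<And>i. i < n \<Longrightarrow> 0 < b i" and i: "i < n"
  shows "0 < x i"
proof -
  define c where "c = Max ((\<lambda>j. 1 / b j) ` {..<n})"
  have c: "1 / b j \<le> c" if "j < n" for j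
    unfolding c_def using that by (intro Max_ge) auto
  have "0 < 1 / b i" using b[OF i] by simp
  then have "0 < c" using c[OF i] by linarith
  moreover have "a i \<le> c * x i"
  proof (rule eigenvalues_at_mono[OF eigenvalues_at_one x _ i])
    show "1 \<le> c * b j" if "j < n" for j
      using c[OF that] b[OF that] by (simp add: field_simps)
  qed (use \<open>0 < c\<close> in simp)
  ultimately show ?thesis using a(2)[OF i] zero_less_mult_pos[of c "x i"] by simp
qed

text \<open>Determinants are multiplicative, and the determinants of \<open>L\<close> and its
  adjoint together contribute exactly the product of \<open>a\<close>; then take logarithms.\<close>

lemma sum_ln_eigenvalues_at:
  assumes x: "eigenvalues_at b x" and b: "\<And>i. i < n \<Longrightarrow> 0 < b i"
  shows "(\<Sum>i<n. ln (x i)) = (\<Sum>i<n. ln (a i)) + (\<Sum>i<n. ln (b i))"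
proof -
  obtain Y where Y: "Y \<in> unitary_mats n" and eq: "conj_diag n L b = conj_diag n Y x"
    using x by (auto simp: eigenvalues_at_def)
  have xp: "0 < x i" if "i < n" for i using eigenvalues_at_pos[OF x b that] .
  have "complex_of_real (\<Prod>i<n. x i) = det L * det (mat_adjoint L) * complex_of_real (\<Prod>i<n. b i)"
    using det_conj_diag_unitary[OF Y, of x] det_conj_diag[OF L, of b] eq by simp
  moreover have "complex_of_real (\<Prod>i<n. a i) = det L * det (mat_adjoint L)"
    using det_conj_diag_unitary[OF Y\<^sub>0, of a] det_conj_diag[OF L, of "\<lambda>_. 1"] gram by simp
  ultimately have "complex_of_real (\<Prod>i<n. x i) = complex_of_real ((\<Prod>i<n. a i) * (\<Prod>i<n. b i))"
    by simp
  then have "(\<Prod>i<n. x i) = (\<Prod>i<n. a i) * (\<Prod>i<n. b i)"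
    by (simp only: of_real_eq_iff)
  then have "ln (\<Prod>i<n. x i) = ln (\<Prod>i<n. a i) + ln (\<Prod>i<n. b i)"
    using prod_pos[of "{..<n}" a] prod_pos[of "{..<n}" b] a(2) b by (simp add: ln_mult_pos)
  moreover have "ln (\<Prod>i<n. x i) = (\<Sum>i<n. ln (x i))" "ln (\<Prod>i<n. a i) = (\<Sum>i<n. ln (a i))"
    "ln (\<Prod>i<n. b i) = (\<Sum>i<n. ln (b i))"
    by (rule ln_prod; simp add: less_imp_neq[OF xp, symmetric] less_imp_neq[OF a(2), symmetric]
        less_imp_neq[OF b, symmetric])+
  ultimately show ?thesis by simp
qed

text \<open>The spectrum \<open>b\<close> is built up from a constant by multiplying all entries above an index \<open>m\<close>
  by a factor \<open>e\<^sup>T \<ge> 1\<close>. By Weyl monotonicity such a step raises each \<open>ln (x i)\<close> by an amount in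
  \<open>[0, T]\<close>, and by the determinant the total increase is \<open>T\<close> times the number of those entries.\<close>

lemma multiplicative_lidskii:
  assumes x: "eigenvalues_at b x" and b: "mono_on {..<n} b" "\<And>i. i < n \<Longrightarrow> 0 < b i"
    and w: "mono_on {..<n} w" and p: "p permutes {..<n}"
  shows "(\<Sum>i<n. w i * (ln (x (p i)) - ln (a (p i)))) \<le> (\<Sum>i<n. w i * ln (b i))"
proof (cases "n = 0")
  case False
  then have n: "0 < n" by simp
  have pn: "p i < n" if "i < n" for i using permutes_in_image[OF p, of i] that by auto
  \<comment> \<open>\<open>b\<close> truncated at index \<open>m\<close>: constant for
    \<open>m = 0\<close>, and equal to \<open>b\<close> below \<open>n\<close> for
    \<open>m = n\<close>, the instance used at the end.\<close>
  define c where "c m i = b (min i m)" for m i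
  have cp: "0 < c m i" if "i < n" for m i using b(2)[of "min i m"] that by (auto simp: c_def)
  have "(\<Sum>i<n. w i * (ln (x (p i)) - ln (a (p i)))) \<le> (\<Sum>i<n. w i * ln (c m i))"
    if "eigenvalues_at (c m) x" for m x
    using that
  proof (induction m arbitrary: x)
    case 0
    have b0: "0 < b 0" using b n by auto
    \<comment> \<open>Equal weights just rescale the spectrum \<open>a\<close>; comparing with the
      constant weight 1 in both directions gives the two inequalities.\<close>
    have "x i = b 0 * a i" if i: "i < n" for i
    proof (rule antisym)
      show "x i \<le> b 0 * a i"
        using b0 i by (intro eigenvalues_at_mono[OF 0 eigenvalues_at_one]) (auto simp: c_def)
      have "a i \<le> 1 / b 0 * x i"
        using b0 i by (intro eigenvalues_at_mono[OF eigenvalues_at_one 0]) (auto simp: c_def)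
      then show "b 0 * a i \<le> x i" using b0 by (simp add: field_simps)
    qed
    then have "ln (x (p i)) - ln (a (p i)) = ln (c 0 i)" if "i < n" for i
      using pn[OF that] a b0 by (simp add: c_def ln_mult_pos)
    then show ?case by simp
  next
    case (Suc m)
    show ?case
    proof (cases "Suc m < n")
      case False
      then have eq: "c (Suc m) i = c m i" if "i < n" for i
        using that by (auto simp: c_def min_def)
      have "eigenvalues_at (c m) x" by (rule eigenvalues_at_cong[OF Suc.prems eq])
      from Suc.IH[OF this] show ?thesis using eq by simp
    next
      case True
      obtain z where z: "eigenvalues_at (c m) z" using eigenvalues_at_exists by blast
      have bm: "0 < b m" "b m \<le> b (Suc m)"
        using b(2)[of m] mono_onD[OF b(1), of m "Suc m"] True by auto
      define t where "t = b (Suc m) / b m"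
      have t: "1 \<le> t" using bm by (simp add: t_def)
      have cs: "c (Suc m) j = (if m < j then t * c m j else c m j)" for j
      proof (cases "m < j")
        case True
        then have "min j (Suc m) = Suc m" "min j m = m" by simp_all
        then show ?thesis using True bm by (simp add: c_def t_def)
      next
        case False
        then have "min j (Suc m) = j" "min j m = j" by simp_all
        then show ?thesis using False by (simp add: c_def)
      qed
      \<comment> \<open>\<open>s\<close> is the logarithmic increment of the weights in this step,
        \<open>g\<close> that of the eigenvalues listed in the order \<open>p\<close>. They have the
        same sum, and each \<open>g i\<close> lies between 0 and \<open>ln t\<close>.\<close>
      define s where "s i = (if m < i then ln t else 0)" for i
      define g where "g i = ln (x (p i)) - ln (z (p i))" for i
      have zp: "0 < z i" if "i < n" for i using eigenvalues_at_pos[OF z cp that] .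
      have xp: "0 < x i" if "i < n" for i using eigenvalues_at_pos[OF Suc.prems cp that] .
      have g: "0 \<le> g i" "g i \<le> ln t" if "i < n" for i
      proof -
        have "z (p i) \<le> 1 * x (p i)"
          using pn[OF that] mono_onD[OF b(1)] True
          by (intro eigenvalues_at_mono[OF z Suc.prems]) (auto simp: c_def)
        then show "0 \<le> g i"
          using zp[OF pn[OF that]] xp[OF pn[OF that]] by (simp add: g_def)
        have "c (Suc m) j \<le> t * c m j" if "j < n" for j
          using cs[of j] cp[OF that, of m] t by (cases "m < j") auto
        then have "x (p i) \<le> t * z (p i)"
          using pn[OF that] t by (intro eigenvalues_at_mono[OF Suc.prems z]) auto
        then have "ln (x (p i)) \<le> ln (t * z (p i))"
          using zp[OF pn[OF that]] xp[OF pn[OF that]] t by simp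
        then show "g i \<le> ln t"
          using zp[OF pn[OF that]] t by (simp add: g_def ln_mult_pos)
      qed
      have s: "ln (c (Suc m) i) = ln (c m i) + s i" if "i < n" for i
        using cs[of i] cp[OF that, of m] t by (cases "m < i") (simp_all add: s_def ln_mult_pos)
      have "(\<Sum>i<n. g i) = (\<Sum>i<n. ln (x i)) - (\<Sum>i<n. ln (z i))"
        unfolding g_def sum_subtractf
        using sum.permute[OF p, of "\<lambda>i. ln (x i)"] sum.permute[OF p, of "\<lambda>i. ln (z i)"]
        by (simp add: o_def)
      also have "\<dots> = (\<Sum>i<n. s i)"
        using sum_ln_eigenvalues_at[OF z cp] sum_ln_eigenvalues_at[OF Suc.prems cp] s
        by (simp add: sum.distrib)
      finally have sums: "(\<Sum>i<n. g i) = (\<Sum>i<n. s i)" .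
      \<comment> \<open>Subtracting the threshold \<open>w m\<close> changes nothing because
        \<open>s\<close> and \<open>g\<close> have equal sums. Above \<open>m\<close> both factors
        are nonnegative, as \<open>s i = ln t\<close> is the largest possible increment; at or below
        \<open>m\<close> both are nonpositive, as \<open>s i = 0\<close> is the smallest. Only these
        bounds on \<open>g\<close> matter, so \<open>p\<close> may be arbitrary.\<close>
      have "0 \<le> (\<Sum>i<n. (w i - w m) * (s i - g i))"
      proof (rule sum_nonneg)
        fix i assume i: "i \<in> {..<n}"
        show "0 \<le> (w i - w m) * (s i - g i)"
        proof (cases "m < i")
          case True
          then show ?thesis using i g mono_onD[OF w, of m i] by (auto simp: s_def)
        next
          case False
          then show ?thesis using i g \<open>Suc m < n\<close> mono_onD[OF w, of i m]
            by (auto simp: s_def intro!: mult_nonpos_nonneg)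
        qed
      qed
      also have "\<dots> = (\<Sum>i<n. w i * s i) - (\<Sum>i<n. w i * g i) - w m * ((\<Sum>i<n. s i) - (\<Sum>i<n. g i))"
        by (simp add: left_diff_distrib right_diff_distrib sum_subtractf sum_distrib_left)
      finally have step: "(\<Sum>i<n. w i * g i) \<le> (\<Sum>i<n. w i * s i)" using sums by simp
      have "(\<Sum>i<n. w i * (ln (x (p i)) - ln (a (p i))))
          = (\<Sum>i<n. w i * g i) + (\<Sum>i<n. w i * (ln (z (p i)) - ln (a (p i))))"
        by (simp add: g_def sum.distrib[symmetric] distrib_left[symmetric])
      also have "\<dots> \<le> (\<Sum>i<n. w i * s i) + (\<Sum>i<n. w i * ln (c m i))"
        by (rule add_mono[OF step Suc.IH[OF z]])
      also have "\<dots> = (\<Sum>i<n. w i * ln (c (Suc m) i))"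
        using s by (simp add: distrib_left sum.distrib)
      finally show ?thesis .
    qed
  qed
  from this[of n x] show ?thesis
    using eigenvalues_at_cong[OF x, of "c n"] by (simp add: c_def)
qed simp

text \<open>The tangent line inequality for the convex function \<open>exp (r * y)\<close> at
  \<open>y = ln v\<close>, evaluated at \<open>y = ln u\<close>.\<close>

lemma powr_diff_ge:
  fixes u v r :: real
  assumes "0 < u" and "0 < v"
  shows "r * v powr r * (ln u - ln v) \<le> u powr r - v powr r"
proof -
  have "v powr r * (1 + r * (ln u - ln v)) \<le> v powr r * exp (r * (ln u - ln v))"
    by (intro mult_left_mono exp_ge_add_one_self) auto
  also have "\<dots> = u powr r"
    using assms by (simp add: powr_def exp_add[symmetric] algebra_simps)
  finally show ?thesis by (simp add: algebra_simps)
qed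

text \<open>Tangents are taken at \<open>ln (x i)\<close>. Their slopes
  \<open>r * x i powr r\<close> ascend with \<open>x\<close>, so they are admissible Lidskii weights
  for the identity permutation.\<close>

lemma sum_powr_eigenvalues_le:
  assumes x: "eigenvalues_at b x" and b: "mono_on {..<n} b" "\<And>i. i < n \<Longrightarrow> 0 < b i" and r: "0 < r"
  shows "(\<Sum>i<n. x i powr r) \<le> (\<Sum>i<n. (a i * b i) powr r)"
proof -
  have xp: "0 < x i" if "i < n" for i using eigenvalues_at_pos[OF x b(2) that] .
  have "mono_on {..<n} x" using x by (simp add: eigenvalues_at_def)
  then have w: "mono_on {..<n} (\<lambda>i. r * x i powr r)"
    using xp r by (auto simp: mono_on_def less_imp_le intro!: mult_left_mono powr_mono2)
  have "0 \<le> (\<Sum>i<n. r * x i powr r * (ln (a i * b i) - ln (x i)))"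
    using multiplicative_lidskii[OF x b w permutes_id] a b
    by (simp add: ln_mult_pos algebra_simps sum_subtractf sum.distrib)
  also have "\<dots> \<le> (\<Sum>i<n. (a i * b i) powr r - x i powr r)"
    using xp a b by (intro sum_mono powr_diff_ge) auto
  finally show ?thesis by (simp add: sum_subtractf)
qed

text \<open>Here tangents are taken at the logarithms of the quotients. Quotients of two ascending
  families need not ascend, so they are first sorted by a permutation, which the Lidskii inequality
  tolerates.\<close>

lemma sum_powr_quotients_le:
  assumes x: "eigenvalues_at b x" and b: "mono_on {..<n} b" "\<And>i. i < n \<Longrightarrow> 0 < b i" and r: "0 < r"
  shows "(\<Sum>i<n. (x i / a i) powr r) \<le> (\<Sum>i<n. b i powr r)"
proof -
  have xp: "0 < x i" if "i < n" for i using eigenvalues_at_pos[OF x b(2) that] .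
  obtain p where p: "p permutes {..<n}" and mono: "mono_on {..<n} (\<lambda>i. x (p i) / a (p i))"
    using sorting_permutation[where n = n and y = "\<lambda>i. x i / a i"] .
  have pn: "p i < n" if "i < n" for i using permutes_in_image[OF p, of i] that by auto
  define y where "y i = x (p i) / a (p i)" for i
  have yp: "0 < y i" if "i < n" for i using pn[OF that] xp a by (simp add: y_def)
  have w: "mono_on {..<n} (\<lambda>i. r * y i powr r)"
    using mono yp r by (auto simp: mono_on_def y_def[symmetric] less_imp_le intro!: mult_left_mono powr_mono2)
  have lny: "ln (y i) = ln (x (p i)) - ln (a (p i))" if "i < n" for i
    using xp[OF pn[OF that]] a(2)[OF pn[OF that]] by (simp add: y_def ln_div)
  have "0 \<le> (\<Sum>i<n. r * y i powr r * (ln (b i) - ln (y i)))"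
    using multiplicative_lidskii[OF x b w p] lny
    by (simp add: right_diff_distrib[of _ "ln (b _)"] sum_subtractf)
  also have "\<dots> \<le> (\<Sum>i<n. b i powr r - y i powr r)"
    using yp b by (intro sum_mono powr_diff_ge) auto
  finally have "(\<Sum>i<n. y i powr r) \<le> (\<Sum>i<n. b i powr r)" by (simp add: sum_subtractf)
  also have "(\<Sum>i<n. y i powr r) = (\<Sum>i<n. (x i / a i) powr r)"
    unfolding y_def using sum.permute[OF p, of "\<lambda>i. (x i / a i) powr r"] unfolding o_def by (rule sym)
  finally show ?thesis .
qed

end

subsection \<open>Positive semidefinite matrices\<close>

lemma conj_diag_add_const:
  assumes "U \<in> unitary_mats n"
  shows "conj_diag n U (\<lambda>i. d i + c) = conj_diag n U d + complex_of_real c \<cdot>\<^sub>m 1\<^sub>m n"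
proof -
  note u = unitary_matsD[OF assms]
  have "real_diag n (\<lambda>i. d i + c) = real_diag n d + complex_of_real c \<cdot>\<^sub>m 1\<^sub>m n"
    by (intro eq_matI) (auto simp: mat_diag_def)
  then show ?thesis
    using u by (simp add: mult_add_distrib_mat[of _ n n _ n] add_mult_distrib_mat[of _ n n _ _ n]
        mult_smult_distrib[of _ n n _ n] mult_smult_assoc_mat[of _ n n _ n])
qed

lemma smult_mat_mult_vec:
  assumes "A \<in> carrier_mat n m" and "v \<in> carrier_vec m"
  shows "(k \<cdot>\<^sub>m A) *\<^sub>v v = k \<cdot>\<^sub>v (A *\<^sub>v v)"
  using assms by (intro eq_vecI) (auto simp: smult_scalar_prod_distrib[of _ m])

lemma conj_diag_nonneg:
  assumes L: "L \<in> carrier_mat n n" and Y: "Y \<in> unitary_mats n" and x: "mono_on {..<n} x"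
    and eq: "conj_diag n L b = conj_diag n Y x" and b: "\<And>i. i < n \<Longrightarrow> 0 \<le> b i" and i: "i < n"
  shows "0 \<le> x i"
proof (rule weyl_monotone[OF Y Y _ x i])
  show "mono_on {..<n} (\<lambda>_. 0 :: real)" by (simp add: mono_on_def)
  fix v :: "complex vec" assume v: "v \<in> carrier_vec n"
  have "wnorm n (\<lambda>_. 0) (mat_adjoint Y *\<^sub>v v) = 0" by (simp add: wnorm_def)
  also have "\<dots> \<le> wnorm n b (mat_adjoint L *\<^sub>v v)" using b by (rule wnorm_nonneg)
  also have "\<dots> = wnorm n x (mat_adjoint Y *\<^sub>v v)"
    by (rule wnorm_cong_conj_diag[OF L unitary_matsD(1)[OF Y] v eq])
  finally show "wnorm n (\<lambda>_. 0) (mat_adjoint Y *\<^sub>v v) \<le> wnorm n x (mat_adjoint Y *\<^sub>v v)" .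
qed

section \<open>Singular factors by invertible perturbation\<close>

lemma norm_add_square_le:
  fixes u w :: complex and e :: real
  assumes e: "0 < e"
  shows "(cmod u)\<^sup>2 \<le> (1 + e) * (cmod (u + complex_of_real e * w))\<^sup>2 + (e + e\<^sup>2) * (cmod w)\<^sup>2"
proof -
  define k l where "k = cmod (u + complex_of_real e * w)" and "l = cmod w"
  have "cmod u = cmod ((u + complex_of_real e * w) - complex_of_real e * w)" by simp
  also have "\<dots> \<le> k + e * l"
    unfolding k_def l_def using e norm_triangle_ineq4[of "u + complex_of_real e * w" "complex_of_real e * w"]
    by (simp add: norm_mult)
  finally have "(cmod u)\<^sup>2 \<le> (k + e * l)\<^sup>2" by (intro power_mono) auto
  \<comment> \<open>The mixed term is absorbed into a square so that the coefficients tend to 1 and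
    0 with \<open>e\<close>; no loss remains in the limit.\<close>
  also have "\<dots> = (1 + e) * k\<^sup>2 + (e + e\<^sup>2) * l\<^sup>2 - e * (k - l)\<^sup>2"
    by (simp add: power2_eq_square algebra_simps)
  also have "\<dots> \<le> (1 + e) * k\<^sup>2 + (e + e\<^sup>2) * l\<^sup>2" using e by simp
  finally show ?thesis by (simp only: k_def l_def)
qed

text \<open>The outer factor may be singular. The locale serves both ranges of \<alpha>:
  \<open>b\<close> is the spectrum of the power of the first state when \<alpha> < 1, and that of
  the sandwiched operator, with \<open>m\<close> the spectrum of the power, when \<alpha> >
  1.\<close>

locale psd_congruence =
  fixes n :: nat and V Z Y :: "complex mat" and s b m :: "nat \<Rightarrow> real"
  assumes V: "V \<in> unitary_mats n" and Z: "Z \<in> unitary_mats n" and Y: "Y \<in> unitary_mats n"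
    and s: "mono_on {..<n} s" "\<And>i. i < n \<Longrightarrow> 0 \<le> s i"
    and b: "mono_on {..<n} b" "\<And>i. i < n \<Longrightarrow> 0 \<le> b i"
    and m: "mono_on {..<n} m"
    and eq: "conj_diag n V s * conj_diag n Z b * conj_diag n V s = conj_diag n Y m"
begin

lemma conj_diag_factor: "conj_diag n (conj_diag n V t * Z) d = conj_diag n V t * conj_diag n Z d * conj_diag n V t"
  using conj_diag_mult[of "conj_diag n V t" n Z d] unitary_matsD[OF V] unitary_matsD[OF Z]
    mat_adjoint_conj_diag[of V n t] by simp

lemma m_nonneg: "i < n \<Longrightarrow> 0 \<le> m i"
  by (rule conj_diag_nonneg[OF _ Y m conj_diag_factor[THEN trans, OF eq] b(2)])
    (use unitary_matsD[OF V] unitary_matsD[OF Z] in auto)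

text \<open>Shifting \<open>s\<close> and \<open>b\<close> by \<open>e\<close> makes the congruence
  invertible, so the Lidskii estimates apply with \<open>(s i + e)\<^sup>2\<close> as
  \<open>a\<close>. The shift changes the coordinates \<open>u\<close> of the original form to
  \<open>u + e w\<close>; \<open>norm_add_square_le\<close> in each coordinate, followed by Weyl
  monotonicity, relates \<open>m\<close> to the new eigenvalues.\<close>

lemma perturbed_eigenvalues:
  assumes e: "0 < e" and r: "0 < r" and B: "\<And>i. i < n \<Longrightarrow> b i \<le> B"
  obtains x where "\<And>i. i < n \<Longrightarrow> m i \<le> (1 + e) * x i + (e + e\<^sup>2) * B"
    and "\<And>i. i < n \<Longrightarrow> 0 < x i"
    and "(\<Sum>i<n. x i powr r) \<le> (\<Sum>i<n. ((s i + e)\<^sup>2 * (b i + e)) powr r)"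
    and "(\<Sum>i<n. (x i / (s i + e)\<^sup>2) powr r) \<le> (\<Sum>i<n. (b i + e) powr r)"
proof -
  note v = unitary_matsD[OF V] and z = unitary_matsD[OF Z] and y = unitary_matsD[OF Y]
  define L where "L = conj_diag n V (\<lambda>i. s i + e) * Z"
  define L0 where "L0 = conj_diag n V s * Z"
  have Lc: "L \<in> carrier_mat n n" and L0c: "L0 \<in> carrier_mat n n"
    using v z by (auto simp: L_def L0_def)
  interpret congruence n L V "\<lambda>i. (s i + e)\<^sup>2"
  proof
    show "mono_on {..<n} (\<lambda>i. (s i + e)\<^sup>2)"
      using s e by (auto simp: mono_on_def intro!: power_mono)
    show "0 < (s i + e)\<^sup>2" if "i < n" for i
      using s(2)[OF that] e by simp
    have one: "conj_diag n Z (\<lambda>_. 1) = 1\<^sub>m n" using z by simp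
    have "conj_diag n L (\<lambda>_. 1) = conj_diag n V (\<lambda>i. s i + e) * conj_diag n V (\<lambda>i. s i + e)"
      unfolding L_def conj_diag_factor one by (simp only: right_mult_one_mat[OF conj_diag_carrier[OF v(1)]])
    also have "\<dots> = conj_diag n V (\<lambda>i. (s i + e)\<^sup>2)"
      unfolding power2_eq_square by (rule conj_diag_mult_conj_diag[OF V])
    finally show "conj_diag n L (\<lambda>_. 1) = conj_diag n V (\<lambda>i. (s i + e)\<^sup>2)" .
  qed (use Lc V in auto)
  obtain x where x: "eigenvalues_at (\<lambda>i. b i + e) x" using eigenvalues_at_exists by blast
  then obtain X where X: "X \<in> unitary_mats n" and xm: "mono_on {..<n} x"
    and xeq: "conj_diag n L (\<lambda>i. b i + e) = conj_diag n X x"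
    by (auto simp: eigenvalues_at_def)
  have be: "mono_on {..<n} (\<lambda>i. b i + e)" "\<And>i. i < n \<Longrightarrow> 0 < b i + e"
    using b e by (auto simp: mono_on_def add_nonneg_pos)
  have "m i \<le> (1 + e) * x i + (e + e\<^sup>2) * B * 1" if i: "i < n" for i
  proof (rule weyl_monotone[OF Y X m _ i])
    show "mono_on {..<n} (\<lambda>i. (1 + e) * x i + (e + e\<^sup>2) * B * 1)"
      using xm e by (auto simp: mono_on_def)
    fix f :: "complex vec" assume f: "f \<in> carrier_vec n"
    define u w where "u = mat_adjoint L0 *\<^sub>v f" and "w = mat_adjoint Z *\<^sub>v f"
    have uw: "u \<in> carrier_vec n" "w \<in> carrier_vec n" using L0c z f by (auto simp: u_def w_def)
    have "mat_adjoint L = mat_adjoint Z * (conj_diag n V s + complex_of_real e \<cdot>\<^sub>m 1\<^sub>m n)"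
      unfolding L_def conj_diag_add_const[OF V, symmetric]
      using v z by (simp only: mat_adjoint_mult[OF conj_diag_carrier z(1)] mat_adjoint_conj_diag)
    also have "\<dots> = mat_adjoint L0 + complex_of_real e \<cdot>\<^sub>m mat_adjoint Z"
      unfolding L0_def mat_adjoint_mult[OF conj_diag_carrier[OF v(1)] z(1)] mat_adjoint_conj_diag[OF v(1)]
      using conj_diag_carrier[OF v(1), of s] z
      by (simp add: mult_add_distrib_mat[of _ n n _ n] mult_smult_distrib[of _ n n _ n])
    finally have "mat_adjoint L *\<^sub>v f = u + complex_of_real e \<cdot>\<^sub>v w"
      unfolding u_def w_def using L0c z f
      by (simp add: add_mult_distrib_mat_vec[of _ n n] smult_mat_mult_vec[of _ n n])
    then have Lf: "(mat_adjoint L *\<^sub>v f) $ j = u $ j + complex_of_real e * w $ j" if "j < n" for j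
      using that uw by simp
    have "wnorm n m (mat_adjoint Y *\<^sub>v f) = wnorm n b u"
      unfolding u_def using eq conj_diag_factor
      by (intro wnorm_cong_conj_diag[OF y(1) L0c f]) (simp add: L0_def)
    also have "\<dots> \<le> (\<Sum>j<n. (1 + e) * ((b j + e) * (cmod ((mat_adjoint L *\<^sub>v f) $ j))\<^sup>2)
        + (e + e\<^sup>2) * B * (1 * (cmod (w $ j))\<^sup>2))"
      unfolding wnorm_def
    proof (intro sum_mono)
      fix j assume "j \<in> {..<n}"
      then have j: "j < n" by simp
      define k where "k = (cmod ((mat_adjoint L *\<^sub>v f) $ j))\<^sup>2"
      have "b j * (cmod (u $ j))\<^sup>2 \<le> b j * ((1 + e) * k + (e + e\<^sup>2) * (cmod (w $ j))\<^sup>2)"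
        unfolding k_def Lf[OF j] by (intro mult_left_mono norm_add_square_le e b j)
      also have "\<dots> = (1 + e) * (b j * k) + (e + e\<^sup>2) * (b j * (cmod (w $ j))\<^sup>2)"
        by (simp add: algebra_simps)
      also have "\<dots> \<le> (1 + e) * ((b j + e) * k) + (e + e\<^sup>2) * (B * (cmod (w $ j))\<^sup>2)"
        using e B[OF j] by (intro add_mono mult_left_mono mult_right_mono) (auto simp: k_def)
      finally show "b j * (cmod (u $ j))\<^sup>2 \<le> (1 + e) * ((b j + e) * (cmod ((mat_adjoint L *\<^sub>v f) $ j))\<^sup>2)
        + (e + e\<^sup>2) * B * (1 * (cmod (w $ j))\<^sup>2)"
        by (simp add: k_def mult.assoc)
    qed
    also have "\<dots> = (1 + e) * wnorm n (\<lambda>j. b j + e) (mat_adjoint L *\<^sub>v f) + (e + e\<^sup>2) * B * wnorm n (\<lambda>_. 1) w"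
      unfolding wnorm_def sum.distrib sum_distrib_left ..
    also have "wnorm n (\<lambda>j. b j + e) (mat_adjoint L *\<^sub>v f) = wnorm n x (mat_adjoint X *\<^sub>v f)"
      by (rule wnorm_cong_conj_diag[OF Lc unitary_matsD(1)[OF X] f xeq])
    \<comment> \<open>Both unitaries preserve the norm, so the error term is a constant weight in
      the eigencoordinates \<open>X\<close> and can be added to the spectrum
      \<open>x\<close>.\<close>
    also have "wnorm n (\<lambda>_. 1) w = wnorm n (\<lambda>_. 1) (mat_adjoint X *\<^sub>v f)"
      unfolding w_def wnorm_unitary[OF Z f] wnorm_unitary[OF X f] ..
    also have "(1 + e) * wnorm n x (mat_adjoint X *\<^sub>v f) + (e + e\<^sup>2) * B * wnorm n (\<lambda>_. 1) (mat_adjoint X *\<^sub>v f)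
        = wnorm n (\<lambda>i. (1 + e) * x i + (e + e\<^sup>2) * B * 1) (mat_adjoint X *\<^sub>v f)"
      unfolding wnorm_add wnorm_scale ..
    finally show "wnorm n m (mat_adjoint Y *\<^sub>v f)
        \<le> wnorm n (\<lambda>i. (1 + e) * x i + (e + e\<^sup>2) * B * 1) (mat_adjoint X *\<^sub>v f)" .
  qed
  then show ?thesis
    using eigenvalues_at_pos[OF x be(2)] sum_powr_eigenvalues_le[OF x be r] sum_powr_quotients_le[OF x be r]
    by (intro that[of x]) auto
qed

text \<open>By \<open>perturbed_eigenvalues\<close>, \<open>low e i\<close> is a lower bound for the eigenvalues of the invertible
  perturbation by \<open>e\<close>; it tends to \<open>m i\<close>, so no continuity of eigenvalues is needed.\<close>

definition bnd :: real where "bnd = (\<Sum>i<n. b i)"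

definition low :: "real \<Rightarrow> nat \<Rightarrow> real" where
  "low e i = max 0 ((m i - (e + e\<^sup>2) * bnd) / (1 + e))"

lemma low_nonneg: "0 \<le> low e i"
  by (simp add: low_def)

lemma low_tendsto: "i < n \<Longrightarrow> ((\<lambda>e. low e i) \<longlongrightarrow> m i) (at_right 0)"
proof -
  assume "i < n"
  then have "m i = max 0 ((m i - (0 + 0\<^sup>2) * bnd) / (1 + 0))" using m_nonneg by simp
  then show ?thesis
    unfolding low_def by (intro tendsto_eq_intros | simp)+
qed

text \<open>Clipping \<open>low\<close> at 0 matters here: where \<open>m i = 0\<close>, the power
  is continuous only along nonnegative bases.\<close>

lemma low_powr_tendsto:
  assumes "i < n" and "0 < r"
  shows "((\<lambda>e. low e i powr r) \<longlongrightarrow> m i powr r) (at_right 0)"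
  using low_tendsto[OF assms(1)] assms(2) by (intro tendsto_powr') (auto simp: low_nonneg)

lemma sum_low_le:
  assumes e: "0 < e" and r: "0 < r"
  shows "(\<Sum>i<n. low e i powr r) \<le> (\<Sum>i<n. ((s i + e)\<^sup>2 * (b i + e)) powr r)"
    and "(\<Sum>i<n. (low e i / (s i + e)\<^sup>2) powr r) \<le> (\<Sum>i<n. (b i + e) powr r)"
proof -
  have "b i \<le> bnd" if "i < n" for i
    unfolding bnd_def using b that by (intro member_le_sum) auto
  then obtain x where x: "\<And>i. i < n \<Longrightarrow> m i \<le> (1 + e) * x i + (e + e\<^sup>2) * bnd"
    "\<And>i. i < n \<Longrightarrow> 0 < x i"
    and le: "(\<Sum>i<n. x i powr r) \<le> (\<Sum>i<n. ((s i + e)\<^sup>2 * (b i + e)) powr r)"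
      "(\<Sum>i<n. (x i / (s i + e)\<^sup>2) powr r) \<le> (\<Sum>i<n. (b i + e) powr r)"
    using perturbed_eigenvalues[OF e r] by blast
  have low: "low e i \<le> x i" if "i < n" for i
    using x[OF that] e by (simp add: low_def divide_le_eq mult.commute)
  have "(\<Sum>i<n. low e i powr r) \<le> (\<Sum>i<n. x i powr r)"
    using low r by (intro sum_mono powr_mono2) (auto simp: low_nonneg)
  then show "(\<Sum>i<n. low e i powr r) \<le> (\<Sum>i<n. ((s i + e)\<^sup>2 * (b i + e)) powr r)"
    using le(1) by (rule order_trans)
  have "(\<Sum>i<n. (low e i / (s i + e)\<^sup>2) powr r) \<le> (\<Sum>i<n. (x i / (s i + e)\<^sup>2) powr r)"
    using low r by (intro sum_mono powr_mono2 divide_right_mono) (auto simp: low_nonneg)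
  then show "(\<Sum>i<n. (low e i / (s i + e)\<^sup>2) powr r) \<le> (\<Sum>i<n. (b i + e) powr r)"
    using le(2) by (rule order_trans)
qed

lemma sum_powr_product_le:
  assumes r: "0 < r"
  shows "(\<Sum>i<n. m i powr r) \<le> (\<Sum>i<n. ((s i)\<^sup>2 * b i) powr r)"
proof (rule tendsto_le[of "at_right (0 :: real)"])
  show "((\<lambda>e. \<Sum>i<n. low e i powr r) \<longlongrightarrow> (\<Sum>i<n. m i powr r)) (at_right 0)"
    using low_powr_tendsto r by (intro tendsto_sum) auto
  show "((\<lambda>e. \<Sum>i<n. ((s i + e)\<^sup>2 * (b i + e)) powr r) \<longlongrightarrow> (\<Sum>i<n. ((s i)\<^sup>2 * b i) powr r)) (at_right 0)"
  proof (intro tendsto_sum tendsto_powr')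
    fix i assume "i \<in> {..<n}"
    then have i: "i < n" by simp
    show "((\<lambda>e. (s i + e)\<^sup>2 * (b i + e)) \<longlongrightarrow> (s i)\<^sup>2 * b i) (at_right 0)"
      by (auto intro!: tendsto_eq_intros)
    have "\<forall>\<^sub>F e in at_right 0. 0 \<le> (s i + e)\<^sup>2 * (b i + e)"
      using eventually_at_right_less by eventually_elim (use b(2)[OF i] in auto)
    then show "(s i)\<^sup>2 * b i \<noteq> 0 \<or> 0 < r \<and> (\<forall>\<^sub>F e in at_right 0. 0 \<le> (s i + e)\<^sup>2 * (b i + e))"
      using r by blast
  qed simp
  show "\<forall>\<^sub>F e in at_right 0. (\<Sum>i<n. low e i powr r) \<le> (\<Sum>i<n. ((s i + e)\<^sup>2 * (b i + e)) powr r)"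
    using eventually_at_right_less by eventually_elim (rule sum_low_le(1)[OF _ r])
qed simp

lemma sum_shift_tendsto:
  assumes r: "0 < r"
  shows "((\<lambda>e. \<Sum>i<n. (b i + e) powr r) \<longlongrightarrow> (\<Sum>i<n. b i powr r)) (at_right 0)"
proof (intro tendsto_sum tendsto_powr')
  fix i assume "i \<in> {..<n}"
  then have i: "i < n" by simp
  show "((\<lambda>e. b i + e) \<longlongrightarrow> b i) (at_right 0)"
    by (auto intro!: tendsto_eq_intros)
  have "\<forall>\<^sub>F e in at_right 0. 0 \<le> b i + e"
    using eventually_at_right_less by eventually_elim (use b(2)[OF i] in auto)
  then show "b i \<noteq> 0 \<or> 0 < r \<and> (\<forall>\<^sub>F e in at_right 0. 0 \<le> b i + e)"
    using r by blast
qed simp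

text \<open>With \<open>s i = 0\<close> the quotient is \<open>low e i / e\<^sup>2\<close>, and the
  estimate for exponent 1 bounds it by a convergent sum. Hence \<open>low e i\<close> tends to 0,
  while its limit is \<open>m i\<close>.\<close>

lemma kernel_eigenvalues:
  assumes i: "i < n" and si: "s i = 0"
  shows "m i = 0"
proof -
  have "m i powr 1 \<le> 0\<^sup>2 * (\<Sum>j<n. b j powr 1)"
  proof (rule tendsto_le[of "at_right (0 :: real)"])
    show "((\<lambda>e. low e i powr 1) \<longlongrightarrow> m i powr 1) (at_right 0)"
      by (rule low_powr_tendsto[OF i]) simp
    show "((\<lambda>e. e\<^sup>2 * (\<Sum>j<n. (b j + e) powr 1)) \<longlongrightarrow> 0\<^sup>2 * (\<Sum>j<n. b j powr 1)) (at_right 0)"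
      by (intro tendsto_mult tendsto_power tendsto_ident_at sum_shift_tendsto) simp
    show "\<forall>\<^sub>F e in at_right 0. low e i powr 1 \<le> e\<^sup>2 * (\<Sum>j<n. (b j + e) powr 1)"
      using eventually_at_right_less
    proof eventually_elim
      fix e :: real assume e: "0 < e"
      have "(low e i / (s i + e)\<^sup>2) powr 1 \<le> (\<Sum>j<n. (low e j / (s j + e)\<^sup>2) powr 1)"
        using i by (intro member_le_sum) auto
      also have "\<dots> \<le> (\<Sum>j<n. (b j + e) powr 1)" by (rule sum_low_le(2)[OF e]) simp
      finally show "low e i powr 1 \<le> e\<^sup>2 * (\<Sum>j<n. (b j + e) powr 1)"
        using e by (simp add: si low_nonneg field_simps)
    qed
  qed simp
  then show ?thesis using m_nonneg[OF i] by simp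
qed

text \<open>Denominators with \<open>s i = 0\<close> vanish in the limit, so these nonnegative terms
  are dropped beforehand; \<open>kernel_eigenvalues\<close> accounts for their indices.\<close>

lemma sum_powr_quotient_le:
  assumes r: "0 < r"
  shows "(\<Sum>i \<in> {i. i < n \<and> 0 < s i}. (m i / (s i)\<^sup>2) powr r) \<le> (\<Sum>i<n. b i powr r)"
proof (rule tendsto_le[of "at_right (0 :: real)"])
  show "((\<lambda>e. \<Sum>i \<in> {i. i < n \<and> 0 < s i}. (low e i / (s i + e)\<^sup>2) powr r)
      \<longlongrightarrow> (\<Sum>i \<in> {i. i < n \<and> 0 < s i}. (m i / (s i)\<^sup>2) powr r)) (at_right 0)"
  proof (intro tendsto_sum tendsto_powr')
    fix i assume "i \<in> {i. i < n \<and> 0 < s i}"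
    then have i: "i < n" "0 < s i" by auto
    show "((\<lambda>e. low e i / (s i + e)\<^sup>2) \<longlongrightarrow> m i / (s i)\<^sup>2) (at_right 0)"
      using i low_tendsto[OF i(1)] by (auto intro!: tendsto_eq_intros)
    show "m i / (s i)\<^sup>2 \<noteq> 0 \<or> 0 < r \<and> (\<forall>\<^sub>F e in at_right 0. 0 \<le> low e i / (s i + e)\<^sup>2)"
      using r by (simp add: low_nonneg)
  qed simp
  show "((\<lambda>e. \<Sum>i<n. (b i + e) powr r) \<longlongrightarrow> (\<Sum>i<n. b i powr r)) (at_right 0)"
    by (rule sum_shift_tendsto[OF r])
  show "\<forall>\<^sub>F e in at_right 0. (\<Sum>i \<in> {i. i < n \<and> 0 < s i}. (low e i / (s i + e)\<^sup>2) powr r)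
      \<le> (\<Sum>i<n. (b i + e) powr r)"
    using eventually_at_right_less
  proof eventually_elim
    fix e :: real assume e: "0 < e"
    have "(\<Sum>i \<in> {i. i < n \<and> 0 < s i}. (low e i / (s i + e)\<^sup>2) powr r)
        \<le> (\<Sum>i<n. (low e i / (s i + e)\<^sup>2) powr r)"
      by (intro sum_mono2) auto
    also have "\<dots> \<le> (\<Sum>i<n. (b i + e) powr r)" by (rule sum_low_le(2)[OF e r])
    finally show "(\<Sum>i \<in> {i. i < n \<and> 0 < s i}. (low e i / (s i + e)\<^sup>2) powr r)
      \<le> (\<Sum>i<n. (b i + e) powr r)" .
  qed
qed simp

end

subsection \<open>Traces and functional calculus\<close>

lemma mat_trace_mult_commute:
  assumes "A \<in> carrier_mat n m" and "B \<in> carrier_mat m n"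
  shows "mat_trace (A * B) = mat_trace (B * A)"
proof -
  have "mat_trace (A * B) = (\<Sum>i<n. \<Sum>j<m. A $$ (i, j) * B $$ (j, i))"
    using assms by (auto simp: mat_trace_def scalar_prod_def atLeast0LessThan intro!: sum.cong)
  also have "\<dots> = (\<Sum>j<m. \<Sum>i<n. A $$ (i, j) * B $$ (j, i))"
    by (rule sum.swap)
  also have "\<dots> = mat_trace (B * A)"
    using assms by (auto simp: mat_trace_def scalar_prod_def atLeast0LessThan mult.commute intro!: sum.cong)
  finally show ?thesis .
qed

lemma mat_trace_conj_diag:
  assumes U: "U \<in> unitary_mats n"
  shows "mat_trace (conj_diag n U d) = complex_of_real (\<Sum>i<n. d i)"
proof -
  note u = unitary_matsD[OF U]
  have "mat_trace (conj_diag n U d) = mat_trace (mat_adjoint U * (U * real_diag n d))"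
    using u by (intro mat_trace_mult_commute[of _ n n]) auto
  also have "mat_adjoint U * (U * real_diag n d) = real_diag n d"
    by (rule mult_unitary_cancel(1)[OF U mat_diag_dim])
  also have "mat_trace (real_diag n d) = complex_of_real (\<Sum>i<n. d i)"
    by (simp add: mat_trace_def mat_diag_def)
  finally show ?thesis .
qed

lemma mat_powr_conj_diag:
  "U \<in> unitary_mats n \<Longrightarrow> mat_powr (conj_diag n U d) t = conj_diag n U (\<lambda>i. d i powr t)"
  unfolding mat_powr_def by (rule mat_fun_eq) auto

lemma conj_diag_cong:
  assumes "\<And>i. i < n \<Longrightarrow> d i = e i"
  shows "conj_diag n L d = conj_diag n L e"
proof -
  have "real_diag n d = real_diag n e"
    using assms by (intro eq_matI) (auto simp: mat_diag_def)
  then show ?thesis by simp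
qed

subsection \<open>Supports\<close>

text \<open>For Hermitian \<open>A\<close> every vector of the form \<open>A u\<close> lies in the
  support. With \<open>u = A w\<close> and \<open>w\<close> in the kernel of \<open>B\<close>, the
  vector \<open>A u\<close> is therefore orthogonal to \<open>w\<close>, and moving \<open>A\<close>
  across gives that \<open>u\<close> has norm 0.\<close>

lemma support_subset_imp_kernel:
  assumes A: "A \<in> carrier_mat n n" "mat_adjoint A = A" and B: "B \<in> carrier_mat n n"
    and sub: "mat_support A \<subseteq> mat_support B" and w: "w \<in> carrier_vec n" "B *\<^sub>v w = 0\<^sub>v n"
  shows "A *\<^sub>v w = 0\<^sub>v n"
proof -
  define u where "u = A *\<^sub>v w"
  have u: "u \<in> carrier_vec n" using A w by (simp add: u_def)
  have "(A *\<^sub>v u) \<bullet>c k = 0" if "k \<in> mat_kernel A" for k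
    using scalar_prod_adjoint[OF A(1) u, of k] A that u by (auto simp: mat_kernel_def)
  then have "A *\<^sub>v u \<in> mat_support A"
    using A u by (auto simp: mat_support_def)
  then have "A *\<^sub>v u \<in> mat_support B" using sub by blast
  then have "(A *\<^sub>v u) \<bullet>c w = 0"
    using B w by (auto simp: mat_support_def mat_kernel_def)
  then have "u \<bullet>c u = 0"
    using scalar_prod_adjoint[OF A(1) u w(1)] A by (simp add: u_def)
  then show ?thesis using u by (simp add: u_def)
qed

lemma support_subset_imp_mult_zero:
  assumes A: "A \<in> carrier_mat n n" "mat_adjoint A = A" and B: "B \<in> carrier_mat n n"
    and sub: "mat_support A \<subseteq> mat_support B"
    and K: "K \<in> carrier_mat n n" and BK: "B * K = 0\<^sub>m n n"
  shows "A * K = 0\<^sub>m n n"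
proof (rule eq_matI)
  fix i j assume ij: "i < dim_row (0\<^sub>m n n :: complex mat)" "j < dim_col (0\<^sub>m n n :: complex mat)"
  have c: "col K j \<in> carrier_vec n" using K ij by auto
  have "B *\<^sub>v col K j = col (B * K) j" using col_mult2[OF B K] ij by simp
  then have "B *\<^sub>v col K j = 0\<^sub>v n" using BK ij by simp
  then have "A *\<^sub>v col K j = 0\<^sub>v n"
    by (rule support_subset_imp_kernel[OF A B sub c])
  then have "col (A * K) j = 0\<^sub>v n" using col_mult2[OF A(1) K] ij by simp
  then have "col (A * K) j $ i = 0" using ij by simp
  then show "(A * K) $$ (i, j) = 0\<^sub>m n n $$ (i, j)" using A K ij by simp
qed (use A K in auto)

lemma mult_mat_zero_vec:
  "A \<in> carrier_mat m n \<Longrightarrow> A *\<^sub>v 0\<^sub>v n = (0\<^sub>v m :: complex vec)"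
  by (intro eq_vecI) auto

lemma support_subset_conj_diag:
  assumes V: "V \<in> unitary_mats n" and pq: "\<And>i. i < n \<Longrightarrow> q i = 0 \<Longrightarrow> p i = 0"
  shows "mat_support (conj_diag n V p) \<subseteq> mat_support (conj_diag n V q)"
proof -
  note v = unitary_matsD[OF V]
  \<comment> \<open>Where \<open>q i = 0\<close>, also \<open>p i = 0\<close>, so the convention for
    division by 0 is harmless. The factorization shows the kernel inclusion, which reverses to one
    of supports.\<close>
  have "conj_diag n V p = conj_diag n V (\<lambda>i. p i / q i * q i)"
    using pq by (intro conj_diag_cong) auto
  then have fac: "conj_diag n V p = conj_diag n V (\<lambda>i. p i / q i) * conj_diag n V q"
    using conj_diag_mult_conj_diag[OF V] by metis
  have "mat_kernel (conj_diag n V q) \<subseteq> mat_kernel (conj_diag n V p)"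
  proof
    fix w assume "w \<in> mat_kernel (conj_diag n V q)"
    then have w: "w \<in> carrier_vec n" "conj_diag n V q *\<^sub>v w = 0\<^sub>v n"
      using v by (auto simp: mat_kernel_def)
    have "conj_diag n V p *\<^sub>v w = conj_diag n V (\<lambda>i. p i / q i) *\<^sub>v (conj_diag n V q *\<^sub>v w)"
      unfolding fac
      by (rule assoc_mult_mat_vec[OF conj_diag_carrier[OF v(1)] conj_diag_carrier[OF v(1)] w(1)])
    also have "\<dots> = 0\<^sub>v n"
      unfolding w(2) by (rule mult_mat_zero_vec[OF conj_diag_carrier[OF v(1)]])
    finally show "w \<in> mat_kernel (conj_diag n V p)"
      using w v by (auto simp: mat_kernel_def)
  qed
  then show ?thesis using v by (auto simp: mat_support_def)
qed

subsection \<open>The trace functional of the \<open>\<alpha>\<close>-\<open>z\<close> relative entropies\<close>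

text \<open>\<open>z = \<alpha>\<close> gives the sandwiched and \<open>z = 1\<close> the Petz trace functional.\<close>

definition alpha_z_op ::
  "nat \<Rightarrow> real \<Rightarrow> real \<Rightarrow> complex mat \<Rightarrow> (nat \<Rightarrow> real) \<Rightarrow> complex mat \<Rightarrow> (nat \<Rightarrow> real) \<Rightarrow> complex mat" where
  "alpha_z_op n \<alpha> z W p V q =
     conj_diag n V (\<lambda>i. q i powr ((1 - \<alpha>) / (2 * z))) * conj_diag n W (\<lambda>i. p i powr (\<alpha> / z))
       * conj_diag n V (\<lambda>i. q i powr ((1 - \<alpha>) / (2 * z)))"

definition alpha_z_trace ::
  "nat \<Rightarrow> real \<Rightarrow> real \<Rightarrow> complex mat \<Rightarrow> (nat \<Rightarrow> real) \<Rightarrow> complex mat \<Rightarrow> (nat \<Rightarrow> real) \<Rightarrow> real" where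
  "alpha_z_trace n \<alpha> z W p V q = Re (mat_trace (mat_powr (alpha_z_op n \<alpha> z W p V q) z))"

lemma powr_square: "((u :: real) powr t)\<^sup>2 = u powr (2 * t)"
  by (simp add: power2_eq_square powr_add[symmetric])

lemma powr_summand:
  assumes "0 < (z :: real)"
  shows "((u powr ((1 - \<alpha>) / (2 * z)))\<^sup>2 * v powr (\<alpha> / z)) powr z = v powr \<alpha> * u powr (1 - \<alpha>)"
proof -
  have "2 * ((1 - \<alpha>) / (2 * z)) * z = 1 - \<alpha>" and "\<alpha> / z * z = \<alpha>"
    using assms by (simp_all add: field_simps)
  then show ?thesis
    by (simp only: powr_square powr_mult powr_powr mult.commute)
qed

text \<open>The spectra are aligned in ascending order while the eigenbases are unrelated; moving
  the first state along its unitary orbit changes only \<open>W\<close>.\<close>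

locale two_states =
  fixes n :: nat and \<alpha> z :: real and W V :: "complex mat" and p q :: "nat \<Rightarrow> real"
  assumes \<alpha>: "0 < \<alpha>" and z: "0 < z"
    and W: "W \<in> unitary_mats n" and V: "V \<in> unitary_mats n"
    and p: "mono_on {..<n} p" "\<And>i. i < n \<Longrightarrow> 0 \<le> p i"
    and q: "mono_on {..<n} q" "\<And>i. i < n \<Longrightarrow> 0 \<le> q i"
begin

lemma alpha_z_op_diagonalization:
  obtains Y x where "Y \<in> unitary_mats n" and "mono_on {..<n} x" and "\<And>i. i < n \<Longrightarrow> 0 \<le> x i"
    and "alpha_z_op n \<alpha> z W p V q = conj_diag n Y x"
proof -
  note v = unitary_matsD[OF V] and w = unitary_matsD[OF W]
  define L where "L = conj_diag n V (\<lambda>i. q i powr ((1 - \<alpha>) / (2 * z))) * W"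
  have L: "L \<in> carrier_mat n n" using v w by (simp add: L_def)
  have op: "alpha_z_op n \<alpha> z W p V q = conj_diag n L (\<lambda>i. p i powr (\<alpha> / z))"
    unfolding alpha_z_op_def L_def
    using conj_diag_mult[OF conj_diag_carrier[OF v(1)] w(1)] by (simp only: mat_adjoint_conj_diag[OF v(1)])
  obtain Y x where Y: "Y \<in> unitary_mats n" "mono_on {..<n} x"
    "conj_diag n L (\<lambda>i. p i powr (\<alpha> / z)) = conj_diag n Y x"
    using hermitian_diagonalization_sorted[OF conj_diag_carrier[OF L] mat_adjoint_conj_diag[OF L]] .
  moreover have "0 \<le> x i" if "i < n" for i
    by (rule conj_diag_nonneg[OF L Y _ that]) simp
  ultimately show ?thesis using op by (intro that[of Y x]) auto
qed

lemma alpha_z_trace_eq: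
  assumes "Y \<in> unitary_mats n" and "alpha_z_op n \<alpha> z W p V q = conj_diag n Y x"
  shows "alpha_z_trace n \<alpha> z W p V q = (\<Sum>i<n. x i powr z)"
  unfolding alpha_z_trace_def assms(2) mat_powr_conj_diag[OF assms(1)] mat_trace_conj_diag[OF assms(1)]
  by simp

text \<open>For \<alpha> < 1 the exponent of \<open>q\<close> is positive, so the spectrum of the
  outer factor ascends with \<open>q\<close> and \<open>sum_powr_product_le\<close> applies with
  exponent \<open>z\<close>.\<close>

lemma alpha_z_trace_le:
  assumes "\<alpha> < 1"
  shows "alpha_z_trace n \<alpha> z W p V q \<le> (\<Sum>i<n. p i powr \<alpha> * q i powr (1 - \<alpha>))"
proof -
  obtain Y x where Y: "Y \<in> unitary_mats n" "mono_on {..<n} x" "\<And>i. i < n \<Longrightarrow> 0 \<le> x i"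
    and op: "alpha_z_op n \<alpha> z W p V q = conj_diag n Y x"
    using alpha_z_op_diagonalization by blast
  interpret psd_congruence n V W Y "\<lambda>i. q i powr ((1 - \<alpha>) / (2 * z))" "\<lambda>i. p i powr (\<alpha> / z)" x
    using V W Y op p q \<alpha> z assms
    by unfold_locales (auto simp: mono_on_def alpha_z_op_def intro!: powr_mono2)
  have "alpha_z_trace n \<alpha> z W p V q \<le> (\<Sum>i<n. ((q i powr ((1 - \<alpha>) / (2 * z)))\<^sup>2 * p i powr (\<alpha> / z)) powr z)"
    unfolding alpha_z_trace_eq[OF Y(1) op] by (rule sum_powr_product_le[OF z])
  also have "\<dots> = (\<Sum>i<n. p i powr \<alpha> * q i powr (1 - \<alpha>))"
    by (simp only: powr_summand[OF z])
  finally show ?thesis .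
qed

lemma alpha_z_trace_ge:
  assumes \<alpha>1: "1 < \<alpha>" and sub: "mat_support (conj_diag n W p) \<subseteq> mat_support (conj_diag n V q)"
  shows "(\<forall>i<n. q i = 0 \<longrightarrow> p i = 0) \<and>
    (\<Sum>i<n. p i powr \<alpha> * q i powr (1 - \<alpha>)) \<le> alpha_z_trace n \<alpha> z W p V q"
proof -
  note v = unitary_matsD[OF V] and w = unitary_matsD[OF W]
  obtain Y x where Y: "Y \<in> unitary_mats n" "mono_on {..<n} x" and x: "\<And>i. i < n \<Longrightarrow> 0 \<le> x i"
    and op: "alpha_z_op n \<alpha> z W p V q = conj_diag n Y x"
    using alpha_z_op_diagonalization by blast
  note tr = alpha_z_trace_eq[OF Y(1) op]
  \<comment> \<open>\<open>T\<close> inverts \<open>S\<close> on the support of the second state and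
    \<open>K\<close> projects onto its kernel; the support inclusion will make \<open>R * K\<close>
    vanish.\<close>
  define S where "S = conj_diag n V (\<lambda>i. q i powr ((1 - \<alpha>) / (2 * z)))"
  define T where "T = conj_diag n V (\<lambda>i. q i powr ((\<alpha> - 1) / (2 * z)))"
  define R where "R = conj_diag n W (\<lambda>i. p i powr (\<alpha> / z))"
  define K where "K = conj_diag n V (\<lambda>i. if q i = 0 then 1 else 0)"
  have c: "S \<in> carrier_mat n n" "T \<in> carrier_mat n n" "R \<in> carrier_mat n n" "K \<in> carrier_mat n n"
    using conj_diag_carrier[OF v(1)] conj_diag_carrier[OF w(1)] by (simp_all add: S_def T_def R_def K_def)
  have adj: "mat_adjoint S = S" "mat_adjoint T = T" "mat_adjoint R = R"
    using mat_adjoint_conj_diag[OF v(1)] mat_adjoint_conj_diag[OF w(1)] by (simp_all add: S_def T_def R_def)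
  have "conj_diag n V q * K = conj_diag n V (\<lambda>i. q i * (if q i = 0 then 1 else 0))"
    unfolding K_def by (rule conj_diag_mult_conj_diag[OF V])
  also have "\<dots> = conj_diag n V (\<lambda>_. 0)" by (rule conj_diag_cong) simp
  also have "\<dots> = 0\<^sub>m n n"
  proof -
    have "real_diag n (\<lambda>_. 0) = 0\<^sub>m n n" by (intro eq_matI) (auto simp: mat_diag_def)
    then show ?thesis using v by simp
  qed
  finally have "conj_diag n W p * K = 0\<^sub>m n n"
    using support_subset_imp_mult_zero[OF conj_diag_carrier[OF w(1)] mat_adjoint_conj_diag[OF w(1)]
        conj_diag_carrier[OF v(1)] sub c(4)] by simp
  then have "mat_adjoint W * (conj_diag n W p * K) = 0\<^sub>m n n" using w by simp
  moreover have "mat_adjoint W * (conj_diag n W p * K) = real_diag n p * (mat_adjoint W * K)"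
    using mult_unitary_cancel(1)[OF W, of "real_diag n p * (mat_adjoint W * K)" n] w c
    by (simp add: assoc_square[of _ n])
  ultimately have pK: "real_diag n p * (mat_adjoint W * K) = 0\<^sub>m n n" by simp
  have WK: "mat_adjoint W * K \<in> carrier_mat n n" using w c by simp
  \<comment> \<open>Read in the eigenbasis \<open>W\<close>, the first state annihilates
    \<open>K\<close> entrywise. Since powers of 0 are 0, the same entries show that \<open>R\<close>
    annihilates \<open>K\<close>.\<close>
  have "p i = 0 \<or> (mat_adjoint W * K) $$ (i, j) = 0" if "i < n" "j < n" for i j
    using arg_cong[OF pK[unfolded mat_diag_mult_left[OF WK]], of "\<lambda>M. M $$ (i, j)"] that by simp
  then have "real_diag n (\<lambda>i. p i powr (\<alpha> / z)) * (mat_adjoint W * K) = 0\<^sub>m n n"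
    unfolding mat_diag_mult_left[OF WK] by (intro eq_matI) force+
  moreover have "R * K = W * (real_diag n (\<lambda>i. p i powr (\<alpha> / z)) * (mat_adjoint W * K))"
    unfolding R_def using w c by (simp add: assoc_square[of _ n])
  ultimately have RK: "R * K = 0\<^sub>m n n" using w by simp
  \<comment> \<open>Where \<open>q i = 0\<close> both powers default to 0, so \<open>T * S\<close>
    is only the support projection; \<open>K\<close> supplies the complement.\<close>
  have TS: "T * S + K = 1\<^sub>m n" and ST: "S * T = T * S"
  proof -
    have comm: "T * S = conj_diag n V (\<lambda>i. q i powr ((\<alpha> - 1) / (2 * z)) * q i powr ((1 - \<alpha>) / (2 * z)))"
      unfolding S_def T_def by (rule conj_diag_mult_conj_diag[OF V])
    then show "S * T = T * S"
      unfolding S_def T_def conj_diag_mult_conj_diag[OF V] by (simp add: mult.commute)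
    have "T * S = conj_diag n V (\<lambda>i. if q i = 0 then 0 else 1)"
      unfolding comm using q(2)
      by (intro conj_diag_cong) (auto simp: powr_add[symmetric] diff_divide_distrib)
    then have "T * S + K = V * (real_diag n (\<lambda>i. if q i = 0 then 0 else 1)
        + real_diag n (\<lambda>i. if q i = 0 then 1 else 0)) * mat_adjoint V"
      unfolding K_def using v
      by (simp add: mult_add_distrib_mat[of _ n n _ n] add_mult_distrib_mat[of _ n n _ _ n])
    also have "real_diag n (\<lambda>i. if q i = 0 then 0 else 1) + real_diag n (\<lambda>i. if q i = 0 then 1 else 0) = 1\<^sub>m n"
      by (intro eq_matI) (auto simp: mat_diag_def)
    finally show "T * S + K = 1\<^sub>m n" using v by simp
  qed
  have "R = R * (T * S + K)" unfolding TS using c by simp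
  also have "\<dots> = R * (T * S) + R * K" using c by (intro mult_add_distrib_mat[of _ n n _ n]) auto
  finally have R1: "R * (T * S) = R" unfolding RK using c by simp
  have R2: "T * S * R = R"
  proof -
    have "mat_adjoint (R * (T * S)) = mat_adjoint (T * S) * mat_adjoint R"
      using c by (intro mat_adjoint_mult[of _ n n _ n]) auto
    also have "mat_adjoint (T * S) = S * T"
      using c adj by (simp add: mat_adjoint_mult[of _ n n _ n])
    finally show ?thesis using R1 adj ST by simp
  qed
  have "T * conj_diag n Y x * T = T * (S * R * S) * T"
    unfolding op[symmetric] by (simp add: alpha_z_op_def S_def R_def)
  also have "\<dots> = (T * S * R) * (S * T)"
    using c by (simp add: assoc_square[of _ n])
  also have "\<dots> = R" unfolding R2 ST by (rule R1)
  finally have TXT: "T * conj_diag n Y x * T = R" .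
  \<comment> \<open>Solving for \<open>R\<close> makes the exponent of \<open>q\<close> positive
    again. Compared with \<open>alpha_z_trace_le\<close>, the spectrum \<open>x\<close> of the
    sandwiched operator now stands in the middle and the powers of \<open>p\<close> are the
    outcome.\<close>
  interpret psd_congruence n V Y W "\<lambda>i. q i powr ((\<alpha> - 1) / (2 * z))" x "\<lambda>i. p i powr (\<alpha> / z)"
  proof
    show "conj_diag n V (\<lambda>i. q i powr ((\<alpha> - 1) / (2 * z))) * conj_diag n Y x
        * conj_diag n V (\<lambda>i. q i powr ((\<alpha> - 1) / (2 * z))) = conj_diag n W (\<lambda>i. p i powr (\<alpha> / z))"
      using TXT unfolding T_def R_def .
  qed (use V W Y x p q \<alpha> z \<alpha>1 in \<open>auto simp: mono_on_def intro!: powr_mono2\<close>)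
  have kern: "p i = 0" if "i < n" "q i = 0" for i
    using kernel_eigenvalues[OF that(1)] that(2) by simp
  have "(\<Sum>i<n. p i powr \<alpha> * q i powr (1 - \<alpha>))
      = (\<Sum>i \<in> {i. i < n \<and> 0 < q i powr ((\<alpha> - 1) / (2 * z))}.
          (p i powr (\<alpha> / z) / (q i powr ((\<alpha> - 1) / (2 * z)))\<^sup>2) powr z)"
  \<comment> \<open>Indices left out have \<open>q i = 0\<close>, and their terms on the left are 0
    because \<open>0 powr (1 - \<alpha>) = 0\<close>.\<close>
  proof (rule sum.mono_neutral_cong_right)
    fix i assume "i \<in> {i. i < n \<and> 0 < q i powr ((\<alpha> - 1) / (2 * z))}"
    then have i: "i < n" "0 < q i" using q(2)[of i] by (auto simp: less_le)
    have "2 * ((\<alpha> - 1) / (2 * z)) * z = \<alpha> - 1" "\<alpha> / z * z = \<alpha>"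
      using z by (simp_all add: field_simps)
    then have "(p i powr (\<alpha> / z) / (q i powr ((\<alpha> - 1) / (2 * z)))\<^sup>2) powr z
        = p i powr \<alpha> / q i powr (\<alpha> - 1)"
      by (simp only: powr_square powr_divide powr_powr powr_ge_zero)
    also have "\<dots> = p i powr \<alpha> * q i powr (1 - \<alpha>)"
      using i powr_minus_divide[of "q i" "\<alpha> - 1"] by simp
    finally show "p i powr \<alpha> * q i powr (1 - \<alpha>)
        = (p i powr (\<alpha> / z) / (q i powr ((\<alpha> - 1) / (2 * z)))\<^sup>2) powr z" ..
  qed (auto simp: less_le)
  also have "\<dots> \<le> alpha_z_trace n \<alpha> z W p V q"
    unfolding tr by (rule sum_powr_quotient_le[OF z])
  finally show ?thesis using kern by blast
qed

lemma alpha_z_trace_aligned: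
  "alpha_z_trace n \<alpha> z V p V q = (\<Sum>i<n. p i powr \<alpha> * q i powr (1 - \<alpha>))"
proof -
  define f where "f i = q i powr ((1 - \<alpha>) / (2 * z)) * p i powr (\<alpha> / z) * q i powr ((1 - \<alpha>) / (2 * z))" for i
  have "alpha_z_op n \<alpha> z V p V q = conj_diag n V f"
    unfolding alpha_z_op_def conj_diag_mult_conj_diag[OF V] f_def ..
  then have "alpha_z_trace n \<alpha> z V p V q = (\<Sum>i<n. f i powr z)"
    unfolding alpha_z_trace_def by (simp only: mat_powr_conj_diag[OF V] mat_trace_conj_diag[OF V] Re_complex_of_real)
  also have "\<dots> = (\<Sum>i<n. ((q i powr ((1 - \<alpha>) / (2 * z)))\<^sup>2 * p i powr (\<alpha> / z)) powr z)"
    unfolding f_def by (simp add: power2_eq_square mult_ac)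
  also have "\<dots> = (\<Sum>i<n. p i powr \<alpha> * q i powr (1 - \<alpha>))"
    by (simp only: powr_summand[OF z])
  finally show ?thesis .
qed

end

subsection \<open>Minimization over the unitary orbit\<close>

lemma ereal_ln_mono: "x \<le> y \<Longrightarrow> ereal_ln x \<le> ereal_ln y"
  by (cases x; cases y) (auto simp: ereal_ln_def)

text \<open>Sorting the list does not change the product of linear factors, and Weyl comparison with
  the zero form gives nonnegative entries.\<close>

lemma density_op_diagonalization:
  assumes A: "A \<in> density_ops n" and a: "eigenvalue_vector A a"
  obtains W where "W \<in> unitary_mats n" and "A = conj_diag n W (\<lambda>i. sort a ! i)"
    and "mono_on {..<n} (\<lambda>i. sort a ! i)" and "\<And>i. i < n \<Longrightarrow> 0 \<le> sort a ! i"
proof -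
  have Ac: "A \<in> carrier_mat n n" and herm: "mat_adjoint A = A"
    and psd: "\<And>v. v \<in> carrier_vec n \<Longrightarrow> 0 \<le> (A *\<^sub>v v) \<bullet>c v"
    using A by (auto simp: density_ops_def pos_semidef_def)
  have len: "length a = n" and cp: "char_poly A = (\<Prod>x\<leftarrow>a. [:- complex_of_real x, 1:])"
    using a Ac by (auto simp: eigenvalue_vector_def)
  have "mset (map (\<lambda>x. [:- complex_of_real x, 1:]) a) = mset (map (\<lambda>x. [:- complex_of_real x, 1:]) (sort a))"
    unfolding mset_map by simp
  then have "char_poly A = (\<Prod>x\<leftarrow>sort a. [:- complex_of_real x, 1:])"
    unfolding cp by (metis prod_mset_prod_list)
  then obtain W where W: "W \<in> unitary_mats n" and eq: "A = conj_diag n W (\<lambda>i. sort a ! i)"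
    using hermitian_diagonalization[OF Ac herm] by blast
  have mono: "mono_on {..<n} (\<lambda>i. sort a ! i)"
    using len by (intro mono_onI) (auto intro!: sorted_nth_mono)
  have "0 \<le> sort a ! i" if i: "i < n" for i
  proof (rule weyl_monotone[OF W W _ mono i, of "\<lambda>_. 0"])
    fix v :: "complex vec" assume v: "v \<in> carrier_vec n"
    have "0 \<le> complex_of_real (wnorm n (\<lambda>i. sort a ! i) (mat_adjoint W *\<^sub>v v))"
      using psd[OF v] quadratic_form_conj_diag[OF unitary_matsD(1)[OF W] v] eq by metis
    then show "wnorm n (\<lambda>_. 0) (mat_adjoint W *\<^sub>v v) \<le> wnorm n (\<lambda>i. sort a ! i) (mat_adjoint W *\<^sub>v v)"
      by (simp add: wnorm_def less_eq_complex_def)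
  qed (simp add: mono_on_def)
  then show ?thesis using that W eq mono by blast
qed

section \<open>Divergences: common form, lower bound and aligned value\<close>

definition alpha_z_divergence ::
  "nat \<Rightarrow> real \<Rightarrow> real \<Rightarrow> complex mat \<Rightarrow> (nat \<Rightarrow> real) \<Rightarrow> complex mat \<Rightarrow> (nat \<Rightarrow> real) \<Rightarrow> ereal" where
  "alpha_z_divergence n \<alpha> z W p V q =
     (if 1 < \<alpha> \<and> \<not> mat_support (conj_diag n W p) \<subseteq> mat_support (conj_diag n V q) then \<infinity>
      else ereal (1 / (\<alpha> - 1)) * ereal_ln (ereal (alpha_z_trace n \<alpha> z W p V q)))"

context two_states
begin

lemma sandwiched_renyi_eq:
  "sandwiched_renyi \<alpha> (conj_diag n W p) (conj_diag n V q) = alpha_z_divergence n \<alpha> \<alpha> W p V q"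
proof -
  have "conj_diag n W (\<lambda>i. p i powr (\<alpha> / \<alpha>)) = conj_diag n W p"
    using \<alpha> p(2) by (intro conj_diag_cong) simp
  then show ?thesis
    unfolding sandwiched_renyi_def alpha_z_divergence_def alpha_z_trace_def alpha_z_op_def
      mat_powr_conj_diag[OF V] by simp
qed

text \<open>At \<open>z = 1\<close> the outer power is trivial on a positive semidefinite operator,
  and cyclicity of the trace merges the two outer factors into one power of the second
  state.\<close>

lemma petz_renyi_eq:
  assumes z1: "z = 1"
  shows "petz_renyi \<alpha> (conj_diag n W p) (conj_diag n V q) = alpha_z_divergence n \<alpha> 1 W p V q"
proof -
  note v = unitary_matsD[OF V] and w = unitary_matsD[OF W]
  define S where "S = conj_diag n V (\<lambda>i. q i powr ((1 - \<alpha>) / (2 * 1)))"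
  define R where "R = conj_diag n W (\<lambda>i. p i powr \<alpha>)"
  have c: "S \<in> carrier_mat n n" "R \<in> carrier_mat n n"
    using conj_diag_carrier[OF v(1)] conj_diag_carrier[OF w(1)] by (simp_all add: S_def R_def)
  have "S * S = conj_diag n V (\<lambda>i. q i powr ((1 - \<alpha>) / (2 * 1)) * q i powr ((1 - \<alpha>) / (2 * 1)))"
    unfolding S_def by (rule conj_diag_mult_conj_diag[OF V])
  also have "\<dots> = mat_powr (conj_diag n V q) (1 - \<alpha>)"
    unfolding mat_powr_conj_diag[OF V] by (intro conj_diag_cong) (simp add: powr_add[symmetric])
  finally have SS: "S * S = mat_powr (conj_diag n V q) (1 - \<alpha>)" .
  obtain Y x where Y: "Y \<in> unitary_mats n" "\<And>i. i < n \<Longrightarrow> 0 \<le> x i"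
    and op: "alpha_z_op n \<alpha> z W p V q = conj_diag n Y x"
    using alpha_z_op_diagonalization by blast
  have "conj_diag n Y (\<lambda>i. x i powr 1) = conj_diag n Y x"
    using Y(2) by (intro conj_diag_cong) simp
  then have "alpha_z_trace n \<alpha> 1 W p V q = Re (mat_trace (S * R * S))"
    using op unfolding alpha_z_trace_def z1
    by (simp add: mat_powr_conj_diag[OF Y(1)]) (simp add: op[unfolded z1, symmetric] alpha_z_op_def S_def R_def)
  also have "mat_trace (S * R * S) = mat_trace (S * (R * S))"
    using c by (simp add: assoc_square[of _ n])
  also have "\<dots> = mat_trace (R * S * S)"
    using c by (intro mat_trace_mult_commute[of _ n n]) auto
  also have "R * S * S = mat_powr (conj_diag n W p) \<alpha> * mat_powr (conj_diag n V q) (1 - \<alpha>)"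
    unfolding SS[symmetric] mat_powr_conj_diag[OF W] R_def[symmetric]
    using c by (simp add: assoc_square[of _ n])
  finally show ?thesis
    unfolding petz_renyi_def alpha_z_divergence_def by simp
qed

text \<open>The prefactor changes sign at 1, so the lower trace bound for \<alpha> > 1 and the upper
  one for \<alpha> < 1 both bound the divergence from below.\<close>

lemma alpha_z_divergence_ge:
  assumes \<alpha>1: "\<alpha> \<noteq> 1"
  shows "ereal (1 / (\<alpha> - 1)) * ereal_ln (\<Sum>i<n. renyi_summand \<alpha> (p i) (q i))
    \<le> alpha_z_divergence n \<alpha> z W p V q"
proof (cases "1 < \<alpha>")
  case True
  show ?thesis
  proof (cases "mat_support (conj_diag n W p) \<subseteq> mat_support (conj_diag n V q)")
    case sub: True
    note ge = alpha_z_trace_ge[OF True sub]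
    \<comment> \<open>The kernel part of \<open>alpha_z_trace_ge\<close> rules out infinite
      summands.\<close>
    have "(\<Sum>i<n. renyi_summand \<alpha> (p i) (q i)) = (\<Sum>i<n. ereal (p i powr \<alpha> * q i powr (1 - \<alpha>)))"
      using ge by (intro sum.cong) (auto simp: renyi_summand_def)
    then have "(\<Sum>i<n. renyi_summand \<alpha> (p i) (q i)) \<le> ereal (alpha_z_trace n \<alpha> z W p V q)"
      using ge by simp
    then show ?thesis
      using True sub unfolding alpha_z_divergence_def
      by (auto intro!: ereal_mult_left_mono ereal_ln_mono)
  next
    case False
    then show ?thesis using True by (simp add: alpha_z_divergence_def)
  qed
next
  case False
  then have "\<alpha> < 1" using \<alpha>1 by simp
  from alpha_z_trace_le[OF this]
  have "ereal_ln (ereal (alpha_z_trace n \<alpha> z W p V q)) \<le> ereal_ln (\<Sum>i<n. renyi_summand \<alpha> (p i) (q i))"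
    using False by (intro ereal_ln_mono) (simp add: renyi_summand_def)
  then have "ereal (1 / (1 - \<alpha>)) * ereal_ln (ereal (alpha_z_trace n \<alpha> z W p V q))
      \<le> ereal (1 / (1 - \<alpha>)) * ereal_ln (\<Sum>i<n. renyi_summand \<alpha> (p i) (q i))"
    using \<open>\<alpha> < 1\<close> by (intro ereal_mult_left_mono) auto
  then have "- (ereal (1 / (1 - \<alpha>)) * ereal_ln (\<Sum>i<n. renyi_summand \<alpha> (p i) (q i)))
      \<le> - (ereal (1 / (1 - \<alpha>)) * ereal_ln (ereal (alpha_z_trace n \<alpha> z W p V q)))"
    by (simp only: ereal_minus_le_minus)
  moreover have "ereal (1 / (\<alpha> - 1)) = - ereal (1 / (1 - \<alpha>))"
    using \<open>\<alpha> < 1\<close> by (simp add: field_simps)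
  ultimately show ?thesis
    using False unfolding alpha_z_divergence_def by (simp only: ereal_mult_minus_left) simp
qed

lemma alpha_z_divergence_aligned:
  "alpha_z_divergence n \<alpha> z V p V q
    = ereal (1 / (\<alpha> - 1)) * ereal_ln (\<Sum>i<n. renyi_summand \<alpha> (p i) (q i))"
proof (cases "1 < \<alpha> \<and> (\<exists>i<n. q i = 0 \<and> p i \<noteq> 0)")
  case True
  then obtain i where i: "i < n" "q i = 0" "p i \<noteq> 0" and \<alpha>1: "1 < \<alpha>" by blast
  then have "renyi_summand \<alpha> (p i) (q i) = \<infinity>"
    using p(2)[OF i(1)] by (simp add: renyi_summand_def)
  then have sum: "(\<Sum>i<n. renyi_summand \<alpha> (p i) (q i)) = \<infinity>"
    using i(1) by (subst sum_Pinfty) auto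
  interpret aligned: two_states n \<alpha> z V V p q
    using \<alpha> z V p q by unfold_locales auto
  \<comment> \<open>An inclusion of supports would, by the trace bound applied to the common basis
    \<open>V\<close>, force \<open>p i = 0\<close>.\<close>
  have "\<not> mat_support (conj_diag n V p) \<subseteq> mat_support (conj_diag n V q)"
    using aligned.alpha_z_trace_ge[OF \<alpha>1] i by blast
  then show ?thesis using \<alpha>1 by (simp add: sum alpha_z_divergence_def ereal_ln_def)
next
  case False
  then have "(\<Sum>i<n. renyi_summand \<alpha> (p i) (q i)) = (\<Sum>i<n. ereal (p i powr \<alpha> * q i powr (1 - \<alpha>)))"
    by (intro sum.cong) (auto simp: renyi_summand_def)
  then have "(\<Sum>i<n. renyi_summand \<alpha> (p i) (q i)) = ereal (alpha_z_trace n \<alpha> z V p V q)"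
    by (simp add: alpha_z_trace_aligned)
  moreover have sub: "\<not> (1 < \<alpha> \<and> \<not> mat_support (conj_diag n V p) \<subseteq> mat_support (conj_diag n V q))"
    using False support_subset_conj_diag[OF V, of q p] by blast
  ultimately show ?thesis unfolding alpha_z_divergence_def if_not_P[OF sub] by simp
qed

end

lemma orbit_minimum:
  fixes D :: "complex mat \<Rightarrow> ereal"
  assumes W: "W \<in> unitary_mats n" and V: "V \<in> unitary_mats n"
    and ge: "\<And>U. U \<in> unitary_mats n \<Longrightarrow> c \<le> D (conj_diag n U p)"
    and eq: "D (conj_diag n V p) = c"
  shows "(INF U \<in> unitary_mats n. D (U * conj_diag n W p * mat_adjoint U)) = c
    \<and> (\<exists>U \<in> unitary_mats n. D (U * conj_diag n W p * mat_adjoint U) = c)"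
proof -
  have conj: "U * conj_diag n W p * mat_adjoint U = conj_diag n (U * W) p" if "U \<in> unitary_mats n" for U
    by (rule conj_diag_mult[OF unitary_matsD(1)[OF that] unitary_matsD(1)[OF W]])
  \<comment> \<open>This \<open>U\<close> carries the eigenbasis \<open>W\<close> to
    \<open>V\<close>, aligning the two ascending spectra.\<close>
  define U where "U = V * mat_adjoint W"
  have U: "U \<in> unitary_mats n"
    unfolding U_def by (rule unitary_mats_mult[OF V unitary_mats_adjoint[OF W]])
  have "U * W = V"
    unfolding U_def using unitary_matsD[OF V] unitary_matsD[OF W] by (simp add: assoc_square[of _ n])
  then have opt: "D (U * conj_diag n W p * mat_adjoint U) = c" using conj[OF U] eq by simp
  moreover have "(INF U \<in> unitary_mats n. D (U * conj_diag n W p * mat_adjoint U)) = c"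
  proof (rule antisym)
    show "(INF U \<in> unitary_mats n. D (U * conj_diag n W p * mat_adjoint U)) \<le> c"
      by (rule INF_lower2[OF U]) (simp add: opt)
    show "c \<le> (INF U \<in> unitary_mats n. D (U * conj_diag n W p * mat_adjoint U))"
      using ge unitary_mats_mult[OF _ W] by (intro INF_greatest) (simp only: conj)
  qed
  ultimately show ?thesis using U by blast
qed

theorem mainTheorem7:
  fixes \<alpha> :: real and n :: nat and \<rho> \<sigma> :: "complex mat" and p q :: "real list"
  assumes "\<alpha> \<in> {0<..<1} \<union> {1<..}"
    and "\<rho> \<in> density_ops n" and "\<sigma> \<in> density_ops n"
    and "eigenvalue_vector \<rho> p" and "eigenvalue_vector \<sigma> q"
  shows "(\<exists>U \<in> unitary_mats n.
           sandwiched_renyi \<alpha> (U * \<rho> * mat_adjoint U) \<sigma> = orbit_sandwiched_renyi \<alpha> \<rho> \<sigma>) \<and>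
         orbit_sandwiched_renyi \<alpha> \<rho> \<sigma> =
           ereal (1 / (\<alpha> - 1)) * ereal_ln (\<Sum>i<n. renyi_summand \<alpha> (sort p ! i) (sort q ! i)) \<and>
         (\<exists>U \<in> unitary_mats n.
           petz_renyi \<alpha> (U * \<rho> * mat_adjoint U) \<sigma> = orbit_petz_renyi \<alpha> \<rho> \<sigma>) \<and>
         orbit_sandwiched_renyi \<alpha> \<rho> \<sigma> = orbit_petz_renyi \<alpha> \<rho> \<sigma>"
proof -
  have \<alpha>: "0 < \<alpha>" "\<alpha> \<noteq> 1" using assms(1) by auto
  have one: "(0 :: real) < 1" by simp
  have dim: "dim_row \<rho> = n" using assms(2) by (auto simp: density_ops_def)
  obtain W where W: "W \<in> unitary_mats n" and \<rho>: "\<rho> = conj_diag n W (\<lambda>i. sort p ! i)"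
    and p: "mono_on {..<n} (\<lambda>i. sort p ! i)" "\<And>i. i < n \<Longrightarrow> 0 \<le> sort p ! i"
    using density_op_diagonalization[OF assms(2,4)] by blast
  obtain V where V: "V \<in> unitary_mats n" and \<sigma>: "\<sigma> = conj_diag n V (\<lambda>i. sort q ! i)"
    and q: "mono_on {..<n} (\<lambda>i. sort q ! i)" "\<And>i. i < n \<Longrightarrow> 0 \<le> sort q ! i"
    using density_op_diagonalization[OF assms(3,5)] by blast
  define c where "c = ereal (1 / (\<alpha> - 1)) * ereal_ln (\<Sum>i<n. renyi_summand \<alpha> (sort p ! i) (sort q ! i))"
  \<comment> \<open>Available for every \<open>z > 0\<close>: \<open>z = \<alpha>\<close> treats the
    sandwiched and \<open>z = 1\<close> the Petz divergence. The bound \<open>c\<close> does not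
    depend on \<open>z\<close>, so the two minima coincide.\<close>
  have states: "two_states n \<alpha> z U V (\<lambda>i. sort p ! i) (\<lambda>i. sort q ! i)"
    if "0 < z" "U \<in> unitary_mats n" for z U
    using that \<alpha> V p q by unfold_locales auto
  have "(INF U \<in> unitary_mats n. sandwiched_renyi \<alpha> (U * \<rho> * mat_adjoint U) \<sigma>) = c
      \<and> (\<exists>U \<in> unitary_mats n. sandwiched_renyi \<alpha> (U * \<rho> * mat_adjoint U) \<sigma> = c)"
    unfolding \<rho> \<sigma>
  proof (rule orbit_minimum[OF W V])
    show "c \<le> sandwiched_renyi \<alpha> (conj_diag n U (\<lambda>i. sort p ! i)) (conj_diag n V (\<lambda>i. sort q ! i))"
      if U: "U \<in> unitary_mats n" for U
      unfolding two_states.sandwiched_renyi_eq[OF states[OF \<alpha>(1) U]] c_def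
      by (rule two_states.alpha_z_divergence_ge[OF states[OF \<alpha>(1) U] \<alpha>(2)])
    show "sandwiched_renyi \<alpha> (conj_diag n V (\<lambda>i. sort p ! i)) (conj_diag n V (\<lambda>i. sort q ! i)) = c"
      unfolding two_states.sandwiched_renyi_eq[OF states[OF \<alpha>(1) V]] c_def
      by (rule two_states.alpha_z_divergence_aligned[OF states[OF \<alpha>(1) V]])
  qed
  moreover have "(INF U \<in> unitary_mats n. petz_renyi \<alpha> (U * \<rho> * mat_adjoint U) \<sigma>) = c
      \<and> (\<exists>U \<in> unitary_mats n. petz_renyi \<alpha> (U * \<rho> * mat_adjoint U) \<sigma> = c)"
    unfolding \<rho> \<sigma>
  proof (rule orbit_minimum[OF W V])
    show "c \<le> petz_renyi \<alpha> (conj_diag n U (\<lambda>i. sort p ! i)) (conj_diag n V (\<lambda>i. sort q ! i))"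
      if U: "U \<in> unitary_mats n" for U
      unfolding two_states.petz_renyi_eq[OF states[OF one U] refl] c_def
      by (rule two_states.alpha_z_divergence_ge[OF states[OF one U] \<alpha>(2)])
    show "petz_renyi \<alpha> (conj_diag n V (\<lambda>i. sort p ! i)) (conj_diag n V (\<lambda>i. sort q ! i)) = c"
      unfolding two_states.petz_renyi_eq[OF states[OF one V] refl] c_def
      by (rule two_states.alpha_z_divergence_aligned[OF states[OF one V]])
  qed
  ultimately show ?thesis
    unfolding orbit_sandwiched_renyi_def orbit_petz_renyi_def dim c_def[symmetric] by metis
qed

end
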